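(* Let $n,d,h,t,u$ be integers such that $1\leqslant u<d-n+t$ and $0<t<h\leqslant n$, and let $x$ be a monomial in $P_n$. Put $I_t=(t+1,t+2,\ldots,n)$. Then $$\phi_{(t;I_t)}(X^{2^{d-u}-1})\,X_h^{2^d-2^{d-u}}\,x^{2^d}\simeq_{n-t+1}\phi_{(t;I_t)}(X^{2^d-1})\,x^{2^d}.$$
   Context: $P_n=\mathbb F_2[x_1,\ldots,x_n]$, $\deg x_i=1$, is a module over the mod-2 Steenrod algebra $\mathcal A$ in the usual way ($Sq^0=\mathrm{id}$, $Sq^1(x_i)=x_i^2$, $Sq^k(x_i)=0$ for $k>1$, Cartan formula). $X_j=\prod_{1\leqslant m\leqslant n,\,m\ne j}x_m\in P_n$ for $1\leqslant j\leqslant n$, and $X=x_1x_2\cdots x_{n-1}\in P_{n-1}$. For a monomial $x=x_1^{a_1}\cdots x_n^{a_n}$ write $\nu_t(x)=a_t$. For $a\geqslant 0$, $\alpha_i(a)\in\{0,1\}$ is the $i$-th dyadic digit, $a=\sum_{i\geqslant 0}\alpha_i(a)2^i$. The weight vector of $x$ is $\omega(x)=(\omega_1(x),\omega_2(x),\ldots)$ with $\omega_i(x)=\sum_j\alpha_{i-1}(\nu_j(x))$. Weight vectors (eventually zero sequences of non-negative integers) are ordered left lexicographically, and $\deg\omega=\sum_{i>0}2^{i-1}\omega_i$. $P_n^-(\omega)$ is the span of all monomials $y\in P_n$ with $\deg y=\deg\omega$ and $\omega(y)<\omega$. $\mathcal A_s^+$ is the span of all $Sq^j$ with $1\leqslant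 j<2^s$. For $f,g\in P_n$ of the same degree, $f\simeq_{(s,\omega)}g$ means $f-g\in\mathcal A_s^+P_n+P_n^-(\omega)$; for a monomial $z$, $z\simeq_s g$ means $z\simeq_{(s,\omega(z))}g$. $\mathcal N_n=\{(i;I): I=(i_1,\ldots,i_r),\ 1\leqslant i<i_1<\cdots<i_r\leqslant n,\ 0\leqslant r<n\}$; $\ell(I)=r$ is the length of $I$. For $1\leqslant i\leqslant n$, $f_i:P_{n-1}\to P_n$ is the algebra homomorphism with $f_i(x_j)=x_j$ for $j<i$ and $f_i(x_j)=x_{j+1}$ for $i\leqslant j<n$. Let $(i;I)\in\mathcal N_n$ with $r=\ell(I)>0$ and $1\leqslant v\leqslant r$. A monomial $x\in P_{n-1}$ is $v$-compatible with $(i;I)$ if: (i) $\nu_{i_1-1}(x)=\cdots=\nu_{i_{v-1}-1}(x)=2^r-1$; (ii) $\nu_{i_v-1}(x)>2^r-1$; (iii) $\alpha_{r-k}(\nu_{i_v-1}(x))=1$ for $1\leqslant k\leqslant v$; (iv) $\alpha_{r-k}(\nu_{i_k-1}(x))=1$ for $v<k\leqslant r$. (At most one such $v$ exists.) Put $x_{(I,v)}=x_{i_v}^{2^{r-1}+\cdots+2^{r-v}}\prod_{v<k\leqslant r}x_{i_k}^{2^{r-k}}$. The $\mathbb F_2$-linear map $\phi_{(i;I)}:P_{n-1}\to P_n$ is given on monomials by $\phi_{(i;I)}(x)=x_i^{2^r-1}f_i(x)/x_{(I,v)}$ if $x$ is $v$-compatible with $(i;I)$ for some $v$, and $\phi_{(i;I)}(x)=0$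 otherwise; $\phi_{(i;\emptyset)}=f_i$. *)

theory Defs
  imports
    "HOL-Library.Poly_Mapping"
    "HOL-Library.Z2"
    "HOL-Computational_Algebra.Polynomial"
begin

subsection \<open>The polynomial algebra over the field with two elements\<close>

text \<open>
  A monomial is given by its exponents, so products of monomials are sums of exponents.
  The algebra in \<open>n\<close> variables is the subset \<open>P n\<close> of the algebra in the variables
  \<open>x\<^sub>0, x\<^sub>1, x\<^sub>2, \<dots>\<close> of the polynomials that involve only \<open>x\<^sub>1, \<dots>, x\<^sub>n\<close>.
\<close>

type_synonym mon = "nat \<Rightarrow>\<^sub>0 nat"
type_synonym pol = "mon \<Rightarrow>\<^sub>0 bit"

abbreviation lookup :: "('a \<Rightarrow>\<^sub>0 'b::zero) \<Rightarrow> 'a \<Rightarrow> 'b" where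
  "lookup \<equiv> Poly_Mapping.lookup"

abbreviation keys :: "('a \<Rightarrow>\<^sub>0 'b::zero) \<Rightarrow> 'a set" where
  "keys \<equiv> Poly_Mapping.keys"

abbreviation nu :: "nat \<Rightarrow> mon \<Rightarrow> nat" where
  "nu t a \<equiv> lookup a t"

definition mono_pol :: "mon \<Rightarrow> pol" where
  "mono_pol a = Poly_Mapping.single a 1"

definition const :: "bit \<Rightarrow> pol" where
  "const c = Poly_Mapping.single 0 c"

definition var :: "nat \<Rightarrow> pol" where
  "var j = mono_pol (Poly_Mapping.single j 1)"

definition mons :: "nat \<Rightarrow> mon set" where
  "mons n = {a. keys a \<subseteq> {1..n}}"

definition P :: "nat \<Rightarrow> pol set" where
  "P n = {p. keys p \<subseteq> mons n}"

definition scaleF2 :: "bit \<Rightarrow> pol \<Rightarrow> pol" where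
  "scaleF2 c p = const c * p"

definition lin_ext :: "(mon \<Rightarrow> pol) \<Rightarrow> pol \<Rightarrow> pol" where
  "lin_ext g p = (\<Sum>a\<in>keys p. scaleF2 (lookup p a) (g a))"

definition mdeg :: "mon \<Rightarrow> nat" where
  "mdeg a = (\<Sum>j\<in>keys a. nu j a)"

definition homogeneous :: "nat \<Rightarrow> pol \<Rightarrow> bool" where
  "homogeneous m p \<longleftrightarrow> (\<forall>a\<in>keys p. mdeg a = m)"

declare add_bit_eq_xor [simp del] mult_bit_eq_and [simp del]

lemma const_0 [simp]: "const 0 = 0" and const_1 [simp]: "const 1 = 1"
  by (simp_all add: const_def)

lemma const_add: "const (c + d) = const c + const d"
  by (simp add: const_def single_add)

lemma const_mult: "const (c * d) = const c * const d"
  by (simp add: const_def mult_single)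

interpretation F2: vector_space scaleF2
  by unfold_locales (simp_all add: scaleF2_def const_add const_mult algebra_simps)

lemma mono_pol_add: "mono_pol (a + b) = mono_pol a * mono_pol b"
  by (simp add: mono_pol_def mult_single)

lemma mono_pol_0 [simp]: "mono_pol 0 = 1"
  by (simp add: mono_pol_def)

lemma keys_mono_pol [simp]: "keys (mono_pol a) = {a}"
  by (simp add: mono_pol_def)

lemma scaleF2_mono_pol: "scaleF2 c (mono_pol a) = Poly_Mapping.single a c"
  by (simp add: scaleF2_def const_def mono_pol_def mult_single)

lemma pol_expand: "p = (\<Sum>a\<in>keys p. scaleF2 (lookup p a) (mono_pol a))"
proof (rule poly_mapping_eqI)
  fix b
  have "lookup (\<Sum>a\<in>keys p. scaleF2 (lookup p a) (mono_pol a)) b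
      = (\<Sum>a\<in>keys p. if a = b then lookup p a else 0)"
    unfolding scaleF2_mono_pol lookup_sum
    by (rule sum.cong) (auto simp: lookup_single when_def)
  also have "\<dots> = lookup p b"
    by (simp add: in_keys_iff)
  finally show "lookup p b = lookup (\<Sum>a\<in>keys p. scaleF2 (lookup p a) (mono_pol a)) b"
    by simp
qed

lemma pol_induct [case_names zero mono add]:
  assumes "Q 0" "\<And>a. Q (mono_pol a)" "\<And>p q. Q p \<Longrightarrow> Q q \<Longrightarrow> Q (p + q)"
  shows "Q (p :: pol)"
proof -
  have "Q (\<Sum>a\<in>A. scaleF2 (lookup p a) (mono_pol a))" if "finite A" for A
    using that
  proof induction
    case (insert a A)
    have "Q (scaleF2 (lookup p a) (mono_pol a))"
      using assms(1,2) by (cases "lookup p a") auto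
    with insert show ?case using assms(3) by simp
  qed (simp add: assms(1))
  from this[of "keys p"] show ?thesis using pol_expand[of p] by simp
qed

lemma lin_ext_mono_pol [simp]: "lin_ext g (mono_pol a) = g a"
  by (simp add: lin_ext_def mono_pol_def)

lemma lin_ext_superset:
  assumes "finite A" "keys p \<subseteq> A"
  shows "lin_ext g p = (\<Sum>a\<in>A. scaleF2 (lookup p a) (g a))"
  unfolding lin_ext_def using assms
  by (intro sum.mono_neutral_left) (auto simp: in_keys_iff)

lemma lin_ext_add: "lin_ext g (p + q) = lin_ext g p + lin_ext g q"
proof -
  let ?A = "keys p \<union> keys q"
  have "keys (p + q) \<subseteq> ?A" by (rule Poly_Mapping.keys_add)
  then show ?thesis
    by (simp add: lin_ext_superset[of ?A] lookup_add F2.scale_left_distrib sum.distrib)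
qed

lemma lin_ext_0 [simp]: "lin_ext g 0 = 0"
  by (simp add: lin_ext_def)


subsection \<open>Steenrod operations\<close>

text \<open>
  The total square is the algebra homomorphism with \<open>x\<^sub>j \<mapsto> x\<^sub>j + x\<^sub>j\<^sup>2 T\<close>, where the powers
  of the formal variable \<open>T\<close> separate the operations; the lemmas below show that these
  are additive and satisfy the defining conditions, including the Cartan formula.
\<close>

definition total_sq :: "pol \<Rightarrow> pol poly" where
  "total_sq p =
     (\<Sum>a\<in>keys p. smult (const (lookup p a)) (\<Prod>j\<in>keys a. [:var j, (var j)\<^sup>2:] ^ nu j a))"

definition Sq :: "nat \<Rightarrow> pol \<Rightarrow> pol" where
  "Sq k p = coeff (total_sq p) k"

lemma total_sq_0 [simp]: "total_sq 0 = 0"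
  by (simp add: total_sq_def)

lemma total_sq_superset:
  assumes "finite A" "keys p \<subseteq> A"
  shows "total_sq p =
     (\<Sum>a\<in>A. smult (const (lookup p a)) (\<Prod>j\<in>keys a. [:var j, (var j)\<^sup>2:] ^ nu j a))"
  unfolding total_sq_def using assms
  by (intro sum.mono_neutral_left) (auto simp: in_keys_iff)

lemma total_sq_add: "total_sq (p + q) = total_sq p + total_sq q"
proof -
  let ?A = "keys p \<union> keys q"
  have "keys (p + q) \<subseteq> ?A" by (rule Poly_Mapping.keys_add)
  then show ?thesis
    by (simp add: total_sq_superset[of ?A] lookup_add const_add smult_add_left sum.distrib)
qed

lemma total_sq_mono_pol:
  assumes "finite A" "keys a \<subseteq> A"
  shows "total_sq (mono_pol a) = (\<Prod>j\<in>A. [:var j, (var j)\<^sup>2:] ^ nu j a)"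
proof -
  have "total_sq (mono_pol a) = (\<Prod>j\<in>keys a. [:var j, (var j)\<^sup>2:] ^ nu j a)"
    by (simp add: total_sq_def mono_pol_def)
  also have "\<dots> = (\<Prod>j\<in>A. [:var j, (var j)\<^sup>2:] ^ nu j a)"
    using assms by (intro prod.mono_neutral_left) (auto simp: in_keys_iff)
  finally show ?thesis .
qed

lemma total_sq_mult: "total_sq (p * q) = total_sq p * total_sq q"
proof (induction p rule: pol_induct)
  case (mono a)
  show ?case
  proof (induction q rule: pol_induct)
    case (mono b)
    let ?A = "keys a \<union> keys b"
    have "keys (a + b) \<subseteq> ?A" by (rule Poly_Mapping.keys_add)
    then show ?case
      by (simp add: mono_pol_add[symmetric] total_sq_mono_pol[of ?A] lookup_add power_add
          prod.distrib)
  qed (simp_all add: distrib_left total_sq_add)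
qed (simp_all add: distrib_right total_sq_add)

lemma Sq_add: "Sq k (p + q) = Sq k p + Sq k q"
  by (simp add: Sq_def total_sq_add)

lemma Sq_cartan: "Sq k (p * q) = (\<Sum>i\<le>k. Sq i p * Sq (k - i) q)"
  by (simp add: Sq_def total_sq_mult coeff_mult)

lemma total_sq_var: "total_sq (var j) = [:var j, (var j)\<^sup>2:]"
  unfolding var_def by (subst total_sq_mono_pol[of "{j}"]) (simp_all add: var_def)

lemma Sq_1_var: "Sq 1 (var j) = (var j)\<^sup>2"
  by (simp add: Sq_def total_sq_var)

lemma Sq_var: "k > 1 \<Longrightarrow> Sq k (var j) = 0"
  by (simp add: Sq_def total_sq_var coeff_pCons split: nat.split)

lemma prod_var: "(\<Prod>j\<in>keys a. var j ^ nu j a) = mono_pol a"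
proof -
  have *: "mono_pol (Poly_Mapping.single j m) = var j ^ m" for j m
  proof (induction m)
    case (Suc m)
    have "Poly_Mapping.single j (Suc m) = Poly_Mapping.single j 1 + Poly_Mapping.single j m"
      by (simp add: single_add[symmetric])
    with Suc show ?case by (simp add: mono_pol_add var_def)
  qed simp
  have exp: "a = (\<Sum>j\<in>keys a. Poly_Mapping.single j (nu j a))"
    by (rule poly_mapping_eqI)
      (simp add: lookup_sum lookup_single when_def in_keys_iff)
  have "mono_pol (\<Sum>j\<in>A. Poly_Mapping.single j (nu j a)) = (\<Prod>j\<in>A. var j ^ nu j a)"
    if "finite A" for A
    using that by induction (simp_all add: mono_pol_add *)
  from this[of "keys a"] exp show ?thesis by simp
qed

lemma Sq_0: "Sq 0 p = p"
proof (induction p rule: pol_induct)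
  case (mono a)
  have "Sq 0 (mono_pol a) = (\<Prod>j\<in>keys a. coeff [:var j, (var j)\<^sup>2:] 0 ^ nu j a)"
    by (simp add: Sq_def total_sq_mono_pol[of "keys a"] poly_0_coeff_0[symmetric]
        poly_prod poly_power)
  then show ?case by (simp add: prod_var)
qed (simp_all add: Sq_add, simp add: Sq_def)

definition SqP :: "nat \<Rightarrow> nat \<Rightarrow> pol set" where
  "SqP s n = F2.span {Sq j p |j p. 1 \<le> j \<and> j < 2 ^ s \<and> p \<in> P n}"


subsection \<open>Weight vectors\<close>

text \<open>
  Weight vectors are indexed from \<open>0\<close>: the entry at \<open>i\<close> is the one usually written
  \<open>\<omega>\<^bsub>i+1\<^esub>\<close>. The order \<open><\<close> on type \<open>nat \<Rightarrow>\<^sub>0 nat\<close> from the library is the left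
  lexicographic order.
\<close>

definition digit :: "nat \<Rightarrow> nat \<Rightarrow> nat" where
  "digit i a = a div 2 ^ i mod 2"

lift_definition weight :: "mon \<Rightarrow> (nat \<Rightarrow>\<^sub>0 nat)"
  is "\<lambda>a i. \<Sum>j | a j \<noteq> 0. digit i (a j)"
proof -
  fix a :: "nat \<Rightarrow> nat"
  assume fin: "finite {j. a j \<noteq> 0}"
  have "digit i (a j) = 0" if "i \<ge> (\<Sum>j | a j \<noteq> 0. a j)" "a j \<noteq> 0" for i j
  proof -
    have "a j \<le> (\<Sum>j | a j \<noteq> 0. a j)"
      using that(2) fin by (intro member_le_sum) auto
    also have "\<dots> \<le> i" by fact
    also have "i < 2 ^ i" by (rule less_exp)
    finally show ?thesis by (simp add: digit_def)
  qed
  then have "{i. (\<Sum>j | a j \<noteq> 0. digit i (a j)) \<noteq> 0} \<subseteq> {..<(\<Sum>j | a j \<noteq> 0. a j)}"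
    by (auto simp: not_less[symmetric] intro: ccontr)
  then show "finite {i. (\<Sum>j | a j \<noteq> 0. digit i (a j)) \<noteq> 0}"
    by (rule finite_subset) simp
qed

lemma lookup_weight: "lookup (weight a) i = (\<Sum>j\<in>keys a. digit i (nu j a))"
  by transfer simp

lemma weight_less_iff:
  "(w :: nat \<Rightarrow>\<^sub>0 nat) < w' \<longleftrightarrow>
     (\<exists>k. lookup w k < lookup w' k \<and> (\<forall>i<k. lookup w i = lookup w' i))"
  by transfer (simp add: less_fun_def)

definition weight_deg :: "(nat \<Rightarrow>\<^sub>0 nat) \<Rightarrow> nat" where
  "weight_deg w = (\<Sum>i\<in>keys w. 2 ^ i * lookup w i)"

definition P_minus :: "nat \<Rightarrow> (nat \<Rightarrow>\<^sub>0 nat) \<Rightarrow> pol set" where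
  "P_minus n w = F2.span {mono_pol y |y. y \<in> mons n \<and> mdeg y = weight_deg w \<and> weight y < w}"

definition equiv_w :: "nat \<Rightarrow> nat \<Rightarrow> (nat \<Rightarrow>\<^sub>0 nat) \<Rightarrow> pol \<Rightarrow> pol \<Rightarrow> bool" where
  "equiv_w n s w f g \<longleftrightarrow>
     f \<in> P n \<and> g \<in> P n \<and> (\<exists>m. homogeneous m f \<and> homogeneous m g) \<and>
     f - g \<in> {a + b |a b. a \<in> SqP s n \<and> b \<in> P_minus n w}"

text \<open>The left-hand side of the following relation has to be a monomial.\<close>

definition equiv_mon :: "nat \<Rightarrow> nat \<Rightarrow> pol \<Rightarrow> pol \<Rightarrow> bool" where
  "equiv_mon n s f g \<longleftrightarrow> (\<exists>z. f = mono_pol z \<and> equiv_w n s (weight z) f g)"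


subsection \<open>The maps from \<open>n - 1\<close> to \<open>n\<close> variables\<close>

definition X_all :: "nat \<Rightarrow> pol" where
  "X_all m = (\<Prod>j\<in>{1..m}. var j)"

definition X_omit :: "nat \<Rightarrow> nat \<Rightarrow> pol" where
  "X_omit n j = (\<Prod>m\<in>{1..n} - {j}. var m)"

definition index_pairs :: "nat \<Rightarrow> (nat \<times> nat list) set" where
  "index_pairs n = {(i, I). 1 \<le> i \<and> sorted_wrt (<) (i # I) \<and> set (i # I) \<subseteq> {..n} \<and> length I < n}"

definition shift_index :: "nat \<Rightarrow> nat \<Rightarrow> nat" where
  "shift_index i j = (if j < i then j else j + 1)"

definition shift_mon :: "nat \<Rightarrow> mon \<Rightarrow> mon" where
  "shift_mon i a = (\<Sum>j\<in>keys a. Poly_Mapping.single (shift_index i j) (nu j a))"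

definition f_hom :: "nat \<Rightarrow> pol \<Rightarrow> pol" where
  "f_hom i = lin_ext (\<lambda>a. mono_pol (shift_mon i a))"

text \<open>Lists are indexed from \<open>0\<close>, the entries of \<open>I = (i\<^sub>1, \<dots>, i\<^sub>r)\<close> from \<open>1\<close>.\<close>

abbreviation entry :: "nat list \<Rightarrow> nat \<Rightarrow> nat" where
  "entry I k \<equiv> I ! (k - 1)"

definition compatible :: "nat \<Rightarrow> nat list \<Rightarrow> mon \<Rightarrow> bool" where
  "compatible v I a \<longleftrightarrow> (let r = length I in
     1 \<le> v \<and> v \<le> r \<and>
     (\<forall>k\<in>{1..<v}. nu (entry I k - 1) a = 2 ^ r - 1) \<and>
     nu (entry I v - 1) a > 2 ^ r - 1 \<and>
     (\<forall>k\<in>{1..v}. digit (r - k) (nu (entry I v - 1) a) = 1) \<and>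
     (\<forall>k\<in>{v<..r}. digit (r - k) (nu (entry I k - 1) a) = 1))"

definition x_Iv :: "nat list \<Rightarrow> nat \<Rightarrow> mon" where
  "x_Iv I v = (let r = length I in
     Poly_Mapping.single (entry I v) (\<Sum>k\<in>{1..v}. 2 ^ (r - k)) +
     (\<Sum>k\<in>{v<..r}. Poly_Mapping.single (entry I k) (2 ^ (r - k))))"

text \<open>
  The difference of exponents is truncated at \<open>0\<close>, but for \<open>(i, I) \<in> index_pairs n\<close> the
  division is exact, see \<open>phi_division\<close>.
\<close>

definition phi_mon :: "nat \<Rightarrow> nat list \<Rightarrow> mon \<Rightarrow> pol" where
  "phi_mon i I a =
     (if \<exists>v. compatible v I a
      then mono_pol (Poly_Mapping.single i (2 ^ length I - 1) + shift_mon i a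
                     - x_Iv I (THE v. compatible v I a))
      else 0)"

definition phi :: "nat \<Rightarrow> nat list \<Rightarrow> pol \<Rightarrow> pol" where
  "phi i I = (if I = [] then f_hom i else lin_ext (phi_mon i I))"

lemma compatible_unique:
  assumes "compatible v I a" "compatible v' I a"
  shows "v = v'"
proof -
  have False if "compatible v I a" "compatible v' I a" "v < v'" for v v'
  proof -
    have "v \<in> {1..<v'}" using that by (auto simp: compatible_def Let_def)
    with that show False by (fastforce simp: compatible_def Let_def)
  qed
  with assms show ?thesis by (meson linorder_neqE_nat)
qed

lemma the_compatible: "compatible v I a \<Longrightarrow> (THE v. compatible v I a) = v"
  using compatible_unique by blast

lemma inj_shift_index: "inj (shift_index i)"
  by (auto simp: inj_def shift_index_def split: if_splits)

lemma lookup_shift_mon: "nu (shift_index i j) (shift_mon i a) = nu j a"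
proof -
  have "nu (shift_index i j) (shift_mon i a) = (\<Sum>k\<in>keys a. if k = j then nu k a else 0)"
    unfolding shift_mon_def lookup_sum
    by (rule sum.cong) (auto simp: lookup_single when_def inj_eq[OF inj_shift_index])
  then show ?thesis by (simp add: in_keys_iff)
qed

lemma lookup_shift_mon_self: "nu i (shift_mon i a) = 0"
  unfolding shift_mon_def lookup_sum
  by (intro sum.neutral) (auto simp: lookup_single when_def shift_index_def)

lemma shift_mon_superset:
  assumes "finite A" "keys a \<subseteq> A"
  shows "shift_mon i a = (\<Sum>j\<in>A. Poly_Mapping.single (shift_index i j) (nu j a))"
  unfolding shift_mon_def using assms
  by (intro sum.mono_neutral_left) (auto simp: in_keys_iff)

lemma shift_mon_add: "shift_mon i (a + b) = shift_mon i a + shift_mon i b"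
proof -
  let ?A = "keys a \<union> keys b"
  have "keys (a + b) \<subseteq> ?A" by (rule Poly_Mapping.keys_add)
  then show ?thesis
    by (simp add: shift_mon_superset[of ?A] lookup_add single_add sum.distrib)
qed

lemma f_hom_add: "f_hom i (p + q) = f_hom i p + f_hom i q"
  by (simp add: f_hom_def lin_ext_add)

lemma f_hom_1: "f_hom i 1 = 1"
  using lin_ext_mono_pol[of "\<lambda>a. mono_pol (shift_mon i a)" 0]
  by (simp add: f_hom_def shift_mon_def)

lemma f_hom_mult: "f_hom i (p * q) = f_hom i p * f_hom i q"
proof (induction p rule: pol_induct)
  case (mono a)
  show ?case
  proof (induction q rule: pol_induct)
    case (mono b)
    show ?case
      unfolding f_hom_def mono_pol_add[symmetric] lin_ext_mono_pol shift_mon_add by simp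
  qed (simp_all add: distrib_left f_hom_add, simp add: f_hom_def)
qed (simp_all add: distrib_right f_hom_add, simp add: f_hom_def)

lemma f_hom_var: "f_hom i (var j) = var (if j < i then j else j + 1)"
  by (simp add: f_hom_def var_def shift_mon_def shift_index_def)

lemma digits_sum_le:
  assumes "finite K" "\<And>k. k \<in> K \<Longrightarrow> digit k a = 1"
  shows "(\<Sum>k\<in>K. 2 ^ k) \<le> a"
proof -
  have *: "(\<Sum>k\<in>K \<inter> {..<N}. 2 ^ k) \<le> a mod 2 ^ N" for N
  proof (induction N)
    case (Suc N)
    have step: "a mod 2 ^ Suc N = 2 ^ N * digit N a + a mod 2 ^ N"
      using mod_mult2_eq[of a "2 ^ N" 2] by (simp add: digit_def mult.commute)
    show ?case
    proof (cases "N \<in> K")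
      case True
      then have "K \<inter> {..<Suc N} = insert N (K \<inter> {..<N})" by auto
      with Suc True assms show ?thesis unfolding step by simp
    next
      case False
      then have "K \<inter> {..<Suc N} = K \<inter> {..<N}" by (auto simp: less_Suc_eq)
      with Suc show ?thesis unfolding step by simp
    qed
  qed simp
  obtain N where "K \<subseteq> {..<N}" using assms(1) finite_nat_bounded by auto
  then have "(\<Sum>k\<in>K. 2 ^ k) \<le> a mod 2 ^ N" using *[of N] by (simp add: Int_absorb2)
  also have "\<dots> \<le> a" by simp
  finally show ?thesis .
qed

lemma upt_index_pairs: "1 \<le> t \<Longrightarrow> t \<le> n \<Longrightarrow> (t, [t+1..<n+1]) \<in> index_pairs n"
  using sorted_wrt_upt[of "t+1" "n+1"] by (auto simp: index_pairs_def simp del: upt_Suc)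

lemma phi_division:
  assumes I: "(i, I) \<in> index_pairs n" and v: "compatible v I a"
  shows "nu j (x_Iv I v) \<le> nu j (shift_mon i a)"
proof -
  define r where "r = length I"
  have vr: "1 \<le> v" "v \<le> r" using v by (auto simp: compatible_def Let_def r_def)
  have sorted: "sorted_wrt (<) I" and above: "\<And>k. k < r \<Longrightarrow> i < I ! k"
    using I by (auto simp: index_pairs_def r_def)
  have shift: "nu (entry I k) (shift_mon i a) = nu (entry I k - 1) a" if "k \<in> {1..r}" for k
  proof -
    have "i < entry I k" using above[of "k - 1"] that by auto
    then have "shift_index i (entry I k - 1) = entry I k" by (auto simp: shift_index_def)
    then show ?thesis using lookup_shift_mon[of i a "entry I k - 1"] by simp
  qed
  have inj: "entry I k = entry I l \<longleftrightarrow> k = l" if "k \<in> {1..r}" "l \<in> {1..r}" for k l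
  proof -
    have "distinct I" using sorted by (simp add: strict_sorted_iff)
    then show ?thesis using that by (auto simp: nth_eq_iff_index_eq r_def)
  qed
  have lookup_x: "nu j (x_Iv I v) =
      ((\<Sum>k\<in>{1..v}. 2 ^ (r - k)) when entry I v = j) +
      (\<Sum>k\<in>{v<..r}. 2 ^ (r - k) when entry I k = j)"
    by (simp add: x_Iv_def Let_def lookup_add lookup_sum lookup_single r_def)
  consider (v) "j = entry I v" | (k) k where "k \<in> {v<..r}" "j = entry I k"
    | (other) "\<forall>k\<in>{v..r}. entry I k \<noteq> j"
    by (metis atLeastAtMost_iff greaterThanAtMost_iff order_le_less)
  then show ?thesis
  proof cases
    case v
    have "(\<Sum>k\<in>{v<..r}. 2 ^ (r - k) when entry I k = j) = (0 :: nat)"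
      using v vr inj by (intro sum.neutral) (auto simp: when_def)
    then have "nu j (x_Iv I v) = (\<Sum>k\<in>{1..v}. 2 ^ (r - k))"
      unfolding lookup_x using v by simp
    also have "\<dots> = (\<Sum>k\<in>(\<lambda>k. r - k) ` {1..v}. 2 ^ k)"
      using vr by (subst sum.reindex) (auto simp: inj_on_def)
    also have "\<dots> \<le> nu (entry I v - 1) a"
      using assms(2) by (intro digits_sum_le) (auto simp: compatible_def Let_def r_def)
    finally show ?thesis using shift[of v] v vr by simp
  next
    case (k l)
    have "(\<Sum>k\<in>{v<..r}. 2 ^ (r - k) when entry I k = j) =
        (\<Sum>k\<in>{v<..r}. if k = l then 2 ^ (r - k) else (0 :: nat))"
      using k vr inj by (intro sum.cong) (auto simp: when_def)
    then have "nu j (x_Iv I v) = 2 ^ (r - l)"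
      unfolding lookup_x using k vr inj[of v l] by simp
    also have "\<dots> \<le> nu (entry I l - 1) a"
      using digits_sum_le[of "{r - l}" "nu (entry I l - 1) a"] v k
      by (simp add: compatible_def Let_def r_def)
    finally show ?thesis using shift[of l] k vr by simp
  next
    case other
    then show ?thesis using vr by (auto simp: lookup_x when_def)
  qed
qed

end

theory Submission
  imports Defs "HOL-Computational_Algebra.Primes"
begin

text \<open>
  Write \<open>[a\<^sub>0, a\<^sub>1, \<dots>]\<close> for the product of the \<open>X\<^bsub>a\<^sub>i\<^esub>\<close> raised to the powers \<open>2\<^sup>i\<close>. Both sides are
  such words, times a power of \<open>x\<close>: both start with \<open>[n, \<dots>, t + 1, t]\<close>, and the last \<open>u\<close>
  letters are \<open>h\<close> on the left and \<open>t\<close> on the right. Up to monomials of lower weight, a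
  square \<open>Sq\<^sup>j\<close> with \<open>j = 2\<^sup>i\<close> acts on a word through its letters from position \<open>i\<close> on, as
  \<open>Sq\<^sup>1\<close>. Applied to \<open>x\<^sub>1 \<cdots> x\<^sub>n\<close> times a suitable square, \<open>Sq\<^sup>1\<close> shows that a block
  \<open>a \<dots> a b\<close> starting at position \<open>i\<close> can be replaced by \<open>b \<dots> b a\<close>; here \<open>i \<le> n - t\<close> is
  allowed. These replacements turn each late \<open>h\<close> into \<open>t\<close>, one at a time.
\<close>

section \<open>Characteristic two: squares and Frobenius powers\<close>

lemma pol_two_eq_0 [simp]: "(2 :: pol) = 0"
proof -
  have "(2 :: pol) = const 1 + const 1" by simp
  also have "\<dots> = const (1 + 1)" by (rule const_add [symmetric])
  finally show ?thesis by simp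
qed

lemma pol_add_self [simp]: "p + p = (0 :: pol)"
  by (subst mult_2 [symmetric]) (simp only: pol_two_eq_0 mult_zero_left)

lemma CHAR_pol [simp]: "CHAR(pol) = 2"
proof (rule CHAR_eq_posI)
  show "of_nat m \<noteq> (0 :: pol)" if "m > 0" "m < 2" for m
  proof -
    have "m = 1" using that by simp
    then show ?thesis by simp
  qed
qed simp_all

lemma pol_sum_power_two: "sum f A ^ 2 ^ i = (\<Sum>a\<in>A. f a ^ 2 ^ i :: pol)"
  using freshmans_dream_sum'[where ?'a = pol, of "2 ^ i" i f A] by simp

lemma pol_poly_add_power_two: "(F + G) ^ 2 ^ i = F ^ 2 ^ i + (G ^ 2 ^ i :: pol poly)"
  using freshmans_dream'[where ?'a = "pol poly", of "2 ^ i" i F G] by simp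

lemma mono_pol_square: "mono_pol a ^ 2 = mono_pol (a + a)"
  by (simp add: mono_pol_add power2_eq_square)

lemma pol_eq_sum_mono_pol: "p = (\<Sum>a\<in>keys p. mono_pol a)"
proof -
  have "scaleF2 (lookup p a) (mono_pol a) = mono_pol a" if "a \<in> keys p" for a
    using that by (cases "lookup p a") (auto simp: in_keys_iff)
  then have "(\<Sum>a\<in>keys p. scaleF2 (lookup p a) (mono_pol a)) = (\<Sum>a\<in>keys p. mono_pol a)"
    by (intro sum.cong) auto
  with pol_expand show ?thesis by (rule trans)
qed

lemma keys_square:
  assumes "b \<in> keys ((p :: pol)\<^sup>2)"
  shows "\<exists>c\<in>keys p. b = c + c"
proof -
  have "p\<^sup>2 = (\<Sum>a\<in>keys p. mono_pol a)\<^sup>2"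
    by (rule arg_cong[where f = "\<lambda>p. p\<^sup>2", OF pol_eq_sum_mono_pol])
  also have "\<dots> = (\<Sum>a\<in>keys p. mono_pol (a + a))"
    using pol_sum_power_two[of mono_pol "keys p" 1] by (simp add: mono_pol_square)
  finally have "b \<in> keys (\<Sum>a\<in>keys p. mono_pol (a + a))"
    using assms by (simp only:)
  then have "b \<in> (\<Union>a\<in>keys p. keys (mono_pol (a + a)))"
    by (rule subsetD [OF keys_sum])
  then show ?thesis by auto
qed

lemma pol_poly_square_pCons: "(pCons a F)\<^sup>2 = pCons (a\<^sup>2) (pCons 0 (F\<^sup>2))" for F :: "pol poly"
proof -
  have "pCons a F = [:a:] + pCons 0 F" by simp
  then have "(pCons a F)\<^sup>2 = [:a:]\<^sup>2 + (pCons 0 F)\<^sup>2"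
    using pol_poly_add_power_two[of "[:a:]" "pCons 0 F" 1] by simp
  then show ?thesis by (simp add: power2_eq_square)
qed

lemma coeff_square: "coeff (F\<^sup>2) k = (if even k then (coeff F (k div 2))\<^sup>2 else 0)"
  for F :: "pol poly"
proof (induction F arbitrary: k)
  case (pCons a F)
  show ?case
  proof (cases k)
    case (Suc k')
    then show ?thesis
    proof (cases k')
      case (Suc k'')
      with \<open>k = Suc k'\<close> show ?thesis by (simp add: pol_poly_square_pCons pCons.IH)
    qed (simp add: pol_poly_square_pCons)
  qed (simp add: pol_poly_square_pCons)
qed simp

text \<open>With \<open>F\<close> the total square of \<open>p\<close>, this reads Sq^(2^i)
  (p^(2^i)) = (Sq^1 p)^(2^i), the passage from an operation at position \<open>i\<close> of a word
  to Sq^1.\<close>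

lemma coeff_power_two: "coeff (F ^ 2 ^ i) (2 ^ i) = (coeff F 1) ^ 2 ^ i" for F :: "pol poly"
proof (induction i)
  case (Suc i)
  then show ?case by (simp add: power_mult coeff_square mult.commute[of 2])
qed simp

section \<open>Total squares of powers, and Sq^1 as a derivation\<close>

lemma total_sq_power: "total_sq (p ^ m) = total_sq p ^ m"
proof (induction m)
  case 0
  show ?case using total_sq_mono_pol[of "{}" 0] by simp
qed (simp add: total_sq_mult)

lemma Sq_1_mult: "Sq 1 (p * q) = Sq 1 p * q + p * Sq 1 q"
  by (simp add: Sq_cartan Sq_0 add.commute)

lemma Sq_1_square: "Sq 1 (p\<^sup>2) = 0"
  unfolding power2_eq_square Sq_1_mult mult.commute[of "Sq 1 p"] by (rule pol_add_self)

text \<open>As a derivation, Sq^1 replaces one factor at a time by its square, which multiplies the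
  squarefree product by that variable.\<close>

lemma Sq_1_prod_var:
  assumes "finite A"
  shows "Sq 1 (\<Prod>j\<in>A. var j) = (\<Sum>j\<in>A. var j * (\<Prod>j\<in>A. var j))"
  using assms
proof (induction rule: finite_induct)
  case empty
  show ?case using Sq_1_square[of 1] by simp
next
  case (insert a A)
  then show ?case
    unfolding prod.insert[OF insert.hyps] sum.insert[OF insert.hyps] Sq_1_mult Sq_1_var
      insert.IH
    by (simp only: power2_eq_square sum_distrib_left mult_ac)
qed

section \<open>Words and their weights\<close>

definition omit_mon :: "nat \<Rightarrow> nat \<Rightarrow> mon" where
  "omit_mon n a = (\<Sum>m\<in>{1..n} - {a}. Poly_Mapping.single m 1)"

text \<open>The word [a_0, ..., a_(i-1)] followed by the tail \<open>q\<close> raised to 2^i. In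
  Horner form each letter costs one squaring, so that arguments about digits become inductions on
  the list.\<close>

primrec word_mon :: "nat \<Rightarrow> mon \<Rightarrow> nat list \<Rightarrow> mon" where
  "word_mon n q [] = q"
| "word_mon n q (a # as) = omit_mon n a + (word_mon n q as + word_mon n q as)"

lemma word_mon_append: "word_mon n q (as @ bs) = word_mon n (word_mon n q bs) as"
  by (induction as) simp_all

lemma nu_omit_mon: "nu j (omit_mon n a) = (if j \<in> {1..n} - {a} then 1 else 0)"
  unfolding omit_mon_def lookup_sum by (simp add: lookup_single when_def)

lemma mono_pol_sum: "mono_pol (\<Sum>j\<in>A. f j) = (\<Prod>j\<in>A. mono_pol (f j))"
  by (induction A rule: infinite_finite_induct) (simp_all add: mono_pol_add)

lemma mono_pol_omit_mon: "mono_pol (omit_mon n a) = X_omit n a"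
  by (simp add: omit_mon_def X_omit_def mono_pol_sum var_def)

lemma mono_pol_word_mon_Cons:
  "mono_pol (word_mon n q (a # as)) = X_omit n a * (mono_pol (word_mon n q as))\<^sup>2"
  by (simp add: mono_pol_add mono_pol_omit_mon power2_eq_square)

lemma mono_pol_word_mon:
  "mono_pol (word_mon n q as) = mono_pol (word_mon n 0 as) * mono_pol q ^ 2 ^ length as"
proof (induction as)
  case (Cons a as)
  have "mono_pol q ^ 2 ^ length (a # as) = (mono_pol q ^ 2 ^ length as)\<^sup>2"
    by (simp add: mult.commute flip: power_mult)
  with Cons show ?case
    unfolding mono_pol_word_mon_Cons by (simp only: power_mult_distrib mult.assoc)
qed simp

text \<open>On monomials in x_1, ..., x_n this is entry \<open>k\<close> of \<open>weight b\<close>,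
  see \<open>lookup_weight_wt\<close>; the fixed range of summation makes weights of different
  monomials comparable term by term.\<close>

definition wt :: "nat \<Rightarrow> mon \<Rightarrow> nat \<Rightarrow> nat" where
  "wt n b k = (\<Sum>j\<in>{1..n}. digit k (nu j b))"

lemma nu_add_double: "nu j (a + (c + c)) = nu j a + 2 * nu j c"
  by (simp add: lookup_add)

lemma wt_0_add_double: "wt n (a + (c + c)) 0 = wt n a 0"
  unfolding wt_def by (intro sum.cong refl) (simp add: digit_def nu_add_double)

text \<open>Exponents at most 1 in \<open>a\<close> produce no carry, so the digits of
  \<open>c\<close> move up by one place.\<close>

lemma wt_Suc_add_double:
  assumes "\<And>j. nu j a \<le> 1"
  shows "wt n (a + (c + c)) (Suc k) = wt n c k"
  unfolding wt_def
proof (intro sum.cong refl)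
  fix j
  have "(nu j a + 2 * nu j c) div 2 = nu j c"
    using assms[of j] by linarith
  then have "(nu j a + 2 * nu j c) div 2 ^ Suc k = nu j c div 2 ^ k"
    by (simp add: div_mult2_eq)
  then show "digit (Suc k) (nu j (a + (c + c))) = digit k (nu j c)"
    by (simp add: digit_def nu_add_double)
qed

lemma wt_0_omit_mon:
  assumes "a \<in> {1..n}"
  shows "wt n (omit_mon n a) 0 = n - 1"
proof -
  have "wt n (omit_mon n a) 0 = (\<Sum>j\<in>{1..n} - {a}. 1)"
    unfolding wt_def by (intro sum.mono_neutral_cong_right) (auto simp: nu_omit_mon digit_def)
  then show ?thesis using assms by simp
qed

lemma wt_omit_mon_Suc: "wt n (omit_mon n a + (c + c)) (Suc k) = wt n c k"
  by (intro wt_Suc_add_double) (simp add: nu_omit_mon)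

lemma wt_word_mon: "set as \<subseteq> {1..n} \<Longrightarrow> k < length as \<Longrightarrow> wt n (word_mon n q as) k = n - 1"
proof (induction as arbitrary: k)
  case (Cons a as)
  then show ?case
    by (cases k) (simp_all add: wt_0_add_double wt_0_omit_mon wt_omit_mon_Suc del: One_nat_def)
qed simp

text \<open>
  All words of length \<open>i\<close> have weight \<open>n - 1\<close> in the positions below \<open>i\<close>, so \<open>low n i b\<close> says that
  \<open>weight b\<close> is smaller than the weight of any such word, whatever follows the word.
\<close>

definition low :: "nat \<Rightarrow> nat \<Rightarrow> mon \<Rightarrow> bool" where
  "low n i b \<longleftrightarrow> (\<exists>k<i. wt n b k < n - 1 \<and> (\<forall>l<k. wt n b l = n - 1))"

lemma low_mono: "low n i b \<Longrightarrow> i \<le> j \<Longrightarrow> low n j b"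
  unfolding low_def by (meson order_less_le_trans)

lemma low_wt_0: "wt n b 0 < n - 1 \<Longrightarrow> 0 < i \<Longrightarrow> low n i b"
  by (auto simp: low_def intro!: exI[of _ 0])

text \<open>The letter fills position 0 with the full value n - 1, so the first defect of
  \<open>c\<close> moves up by one place.\<close>

lemma low_omit_mon:
  assumes "a \<in> {1..n}" "low n i c"
  shows "low n (Suc i) (omit_mon n a + (c + c))"
proof -
  obtain k where "k < i" "wt n c k < n - 1" "\<forall>l<k. wt n c l = n - 1"
    using assms(2) by (auto simp: low_def)
  then show ?thesis
    using wt_0_omit_mon[OF assms(1)] unfolding low_def
    by (intro exI[of _ "Suc k"])
      (auto simp: wt_omit_mon_Suc wt_0_add_double less_Suc_eq_0_disj simp del: One_nat_def)
qed

lemma low_word_mon: "set as \<subseteq> {1..n} \<Longrightarrow> low n i q \<Longrightarrow> low n (length as + i) (word_mon n q as)"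
  by (induction as) (auto intro: low_omit_mon simp del: One_nat_def)

section \<open>The total square of a word modulo lower weight\<close>

definition Low :: "nat \<Rightarrow> nat \<Rightarrow> pol set" where
  "Low n i = {f. \<forall>b\<in>keys f. low n i b}"

lemma Low_add: "f \<in> Low n i \<Longrightarrow> g \<in> Low n i \<Longrightarrow> f + g \<in> Low n i"
  using keys_add[of f g] by (auto simp: Low_def)

lemma Low_0 [simp]: "0 \<in> Low n i"
  by (simp add: Low_def)

lemma Low_sum: "(\<And>j. j \<in> A \<Longrightarrow> f j \<in> Low n i) \<Longrightarrow> sum f A \<in> Low n i"
  by (induction A rule: infinite_finite_induct) (simp_all add: Low_add)

text \<open>Expand the product of the x_j + x_j^2 T: every term other than the product of all x_j
  contains some x_j^2, hence has fewer than \<open>card A\<close> odd exponents. The clause on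
  exponents outside \<open>A\<close> serves the induction: the next variable does not yet occur in
  the remainder.\<close>

lemma total_sq_prod_var_low:
  assumes "finite A" "A \<subseteq> {1..n}"
  shows "\<exists>D. total_sq (\<Prod>j\<in>A. var j) = [:\<Prod>j\<in>A. var j:] + D \<and>
    (\<forall>k. \<forall>b\<in>keys (coeff D k). wt n b 0 < card A \<and> (\<forall>j. j \<notin> A \<longrightarrow> nu j b = 0))"
  using assms
proof (induction rule: finite_induct)
  case empty
  show ?case using total_sq_mono_pol[of "{}" 0] by (intro exI[of _ 0]) (auto simp: one_pCons)
next
  case (insert a A)
  then obtain D where D: "total_sq (\<Prod>j\<in>A. var j) = [:\<Prod>j\<in>A. var j:] + D"
    "\<And>k b. b \<in> keys (coeff D k) \<Longrightarrow> wt n b 0 < card A \<and> (\<forall>j. j \<notin> A \<longrightarrow> nu j b = 0)"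
    by auto
  have a: "a \<in> {1..n}" using insert by auto
  define m where "m = (\<Sum>j\<in>A. Poly_Mapping.single j (1 :: nat))"
  have m: "(\<Prod>j\<in>A. var j) = mono_pol m"
    by (simp add: m_def mono_pol_sum var_def)
  have nu_m: "nu j m = (if j \<in> A then 1 else 0)" for j
    using insert.hyps by (simp add: m_def lookup_sum lookup_single when_def)
  have nu_add: "wt n (Poly_Mapping.single a i + b) 0 = wt n b 0 + i mod 2"
    if "nu a b = 0" for i b
  proof -
    have "wt n (Poly_Mapping.single a i + b) 0
        = (\<Sum>j\<in>{1..n}. digit 0 (nu j b) + (if j = a then i mod 2 else 0))"
      unfolding wt_def using that
      by (intro sum.cong) (auto simp: digit_def lookup_add lookup_single when_def)
    then show ?thesis using a by (simp add: wt_def sum.distrib)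
  qed
  have "wt n m 0 = card A"
    using insert.prems by (simp add: wt_def nu_m digit_def if_distrib sum.If_cases Int_absorb1 cong: if_cong)
  define D' where "D' = pCons 0 [:(var a)\<^sup>2 * mono_pol m:] + [:var a, (var a)\<^sup>2:] * D"
  have "total_sq (\<Prod>j\<in>insert a A. var j) = [:var a, (var a)\<^sup>2:] * ([:mono_pol m:] + D)"
    using insert.hyps D(1) m by (simp add: total_sq_mult total_sq_var)
  also have "\<dots> = [:\<Prod>j\<in>insert a A. var j:] + D'"
    using insert.hyps m by (simp add: D'_def distrib_left)
  finally have eq: "total_sq (\<Prod>j\<in>insert a A. var j) = [:\<Prod>j\<in>insert a A. var j:] + D'" .
  have sq: "(var a)\<^sup>2 = mono_pol (Poly_Mapping.single a 2)"
  proof -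
    have "Poly_Mapping.single a (1 + 1) = Poly_Mapping.single a 1 + Poly_Mapping.single a (1 :: nat)"
      by (rule single_add)
    then show ?thesis unfolding var_def mono_pol_square by (simp only: one_add_one)
  qed
  have vm: "b \<in> keys (var a * f) \<Longrightarrow> \<exists>c\<in>keys f. b = Poly_Mapping.single a 1 + c"
    "b \<in> keys ((var a)\<^sup>2 * f) \<Longrightarrow> \<exists>c\<in>keys f. b = Poly_Mapping.single a 2 + c" for b f
    using keys_mult[of "var a" f] keys_mult[of "(var a)\<^sup>2" f] unfolding sq unfolding var_def
    by (auto simp del: One_nat_def)
  have "wt n b 0 < card (insert a A) \<and> (\<forall>j. j \<notin> insert a A \<longrightarrow> nu j b = 0)"
    if b: "b \<in> keys (coeff D' k)" for b k
  proof -
    have "coeff D' k = (if k = 1 then (var a)\<^sup>2 * mono_pol m else 0) + var a * coeff D k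
        + (if k = 0 then 0 else (var a)\<^sup>2 * coeff D (k - 1))"
      by (cases k; cases "k - 1") (simp_all add: D'_def algebra_simps)
    then have "b \<in> keys (if k = 1 then (var a)\<^sup>2 * mono_pol m else 0) \<union> keys (var a * coeff D k)
        \<union> keys (if k = 0 then 0 else (var a)\<^sup>2 * coeff D (k - 1))"
      using b by (auto dest!: subsetD [OF keys_add])
    then consider "b \<in> keys ((var a)\<^sup>2 * mono_pol m)" | "b \<in> keys (var a * coeff D k)"
      | "b \<in> keys ((var a)\<^sup>2 * coeff D (k - 1))"
      by (auto split: if_splits)
    then show ?thesis
    proof cases
      case 1
      then have "b = Poly_Mapping.single a 2 + m" using vm(2) by fastforce
      then show ?thesis using insert.hyps nu_add[of m 2] \<open>wt n m 0 = card A\<close>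
        by (auto simp: nu_m lookup_add lookup_single)
    next
      case 2
      then obtain c where "c \<in> keys (coeff D k)" "b = Poly_Mapping.single a 1 + c" using vm(1) by blast
      then show ?thesis using insert.hyps nu_add[of c 1] D(2)[of c k]
        by (auto simp: lookup_add lookup_single simp del: One_nat_def)
    next
      case 3
      then obtain c where "c \<in> keys (coeff D (k-1))" "b = Poly_Mapping.single a 2 + c" using vm(2) by blast
      then show ?thesis using insert.hyps nu_add[of c 2] D(2)[of c "k - 1"]
        by (auto simp: lookup_add lookup_single)
    qed
  qed
  then show ?case using eq by blast
qed

text \<open>One letter splits off as (X_a + D) Q^2, with Q the expression for the shorter word.
  Squaring moves the defects of the old remainder up by one place, and \<open>D\<close> has a defect
  at position 0 already. The factor \<open>H\<close> stands for the total square of the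
  tail.\<close>

lemma total_sq_word_low:
  assumes "set as \<subseteq> {1..n}"
  shows "\<exists>L. total_sq (mono_pol (word_mon n 0 as)) * H ^ 2 ^ length as
      = [:mono_pol (word_mon n 0 as):] * H ^ 2 ^ length as + L
    \<and> (\<forall>k. coeff L k \<in> Low n (length as))"
  using assms
proof (induction as)
  case Nil
  show ?case using total_sq_mono_pol[of "{}" 0] by (intro exI[of _ 0]) (auto simp: one_pCons Low_def)
next
  case (Cons a as)
  let ?w = "mono_pol (word_mon n 0 as)" and ?i = "length as"
  obtain L where L: "total_sq ?w * H ^ 2 ^ ?i = [:?w:] * H ^ 2 ^ ?i + L"
    "\<And>k. coeff L k \<in> Low n ?i" using Cons by auto
  have a: "a \<in> {1..n}" using Cons.prems by auto
  then have card: "card ({1..n} - {a}) = n - 1" by simp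
  obtain D where D: "total_sq (X_omit n a) = [:X_omit n a:] + D"
    "\<And>k b. b \<in> keys (coeff D k) \<Longrightarrow> wt n b 0 < n - 1"
    using total_sq_prod_var_low[of "{1..n} - {a}" n] unfolding card X_omit_def by blast
  let ?Q = "total_sq ?w * H ^ 2 ^ ?i"
  let ?w' = "mono_pol (word_mon n 0 (a # as))"
  have w': "?w' = X_omit n a * ?w\<^sup>2"
    by (rule mono_pol_word_mon_Cons)
  have H: "H ^ 2 ^ length (a # as) = (H ^ 2 ^ ?i)\<^sup>2"
    by (simp add: mult.commute flip: power_mult)
  define L' where "L' = [:X_omit n a:] * L\<^sup>2 + D * ?Q\<^sup>2"
  have "total_sq ?w' * H ^ 2 ^ length (a # as) = ([:X_omit n a:] + D) * ?Q\<^sup>2"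
    unfolding w' H total_sq_mult total_sq_power D(1) by (simp add: power_mult_distrib mult_ac)
  also have "\<dots> = [:X_omit n a:] * ([:?w:] * H ^ 2 ^ ?i + L)\<^sup>2 + D * ?Q\<^sup>2"
    unfolding distrib_right L(1) ..
  also have "([:?w:] * H ^ 2 ^ ?i + L)\<^sup>2 = ([:?w:] * H ^ 2 ^ ?i)\<^sup>2 + L\<^sup>2"
    using pol_poly_add_power_two[of "[:?w:] * H ^ 2 ^ ?i" L 1] by simp
  also have "[:X_omit n a:] * (([:?w:] * H ^ 2 ^ ?i)\<^sup>2 + L\<^sup>2) + D * ?Q\<^sup>2
      = [:?w':] * H ^ 2 ^ length (a # as) + L'"
  proof -
    have "[:?w':] = [:X_omit n a:] * [:?w:]\<^sup>2" unfolding w' by (simp add: power2_eq_square)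
    then show ?thesis
      unfolding H L'_def by (simp only: distrib_left power_mult_distrib mult.assoc add.assoc)
  qed
  finally have eq: "total_sq ?w' * H ^ 2 ^ length (a # as) = [:?w':] * H ^ 2 ^ length (a # as) + L'" .
  have "coeff L' k \<in> Low n (length (a # as))" for k
  proof -
    \<comment> \<open>Odd coefficients of the square vanish and even ones are squares, so each
      monomial here is X_a times the square of a low one.\<close>
    have "coeff ([:X_omit n a:] * L\<^sup>2) k \<in> Low n (Suc ?i)"
    proof -
      have "low n (Suc ?i) b" if b: "b \<in> keys (X_omit n a * (coeff L l)\<^sup>2)" for b l
      proof -
        have "b \<in> {x + y |x y. x \<in> keys (X_omit n a) \<and> y \<in> keys ((coeff L l)\<^sup>2)}"
          using b keys_mult by blast
        then obtain c where "c \<in> keys (coeff L l)" "b = omit_mon n a + (c + c)"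
          using keys_square by (fastforce simp: simp flip: mono_pol_omit_mon)
        then show ?thesis using L(2)[of l] low_omit_mon[OF a] by (simp add: Low_def)
      qed
      then show ?thesis by (simp add: coeff_square Low_def)
    qed
    moreover have "coeff (D * ?Q\<^sup>2) k \<in> Low n (Suc ?i)"
      unfolding coeff_mult
    proof (rule Low_sum)
      fix j
      have "low n (Suc ?i) b" if b: "b \<in> keys (coeff D j * f\<^sup>2)" for b f
      proof -
        have "b \<in> {x + y |x y. x \<in> keys (coeff D j) \<and> y \<in> keys (f\<^sup>2)}"
          using b keys_mult by blast
        then obtain d c where "d \<in> keys (coeff D j)" "b = d + (c + c)"
          using keys_square by blast
        then show ?thesis using D(2)[of d j] by (intro low_wt_0) (simp_all add: wt_0_add_double)
      qed
      then show "coeff D j * coeff (?Q\<^sup>2) (k - j) \<in> Low n (Suc ?i)"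
        by (simp add: coeff_square[of ?Q] Low_def)
    qed
    ultimately show ?thesis by (simp add: L'_def Low_add)
  qed
  with eq show ?case by blast
qed

section \<open>Degrees and homogeneous polynomials\<close>

lemma mdeg_superset: "finite A \<Longrightarrow> keys a \<subseteq> A \<Longrightarrow> mdeg a = (\<Sum>j\<in>A. nu j a)"
  unfolding mdeg_def by (intro sum.mono_neutral_left) (auto simp: in_keys_iff)

lemma mdeg_add: "mdeg (a + b) = mdeg a + mdeg b"
  using mdeg_superset[of "keys a \<union> keys b"] keys_add[of a b]
  by (simp add: lookup_add sum.distrib)

lemma mdeg_0 [simp]: "mdeg 0 = 0"
  by (simp add: mdeg_def)

lemma mdeg_single [simp]: "mdeg (Poly_Mapping.single j m) = m"
  by (simp add: mdeg_def)

lemma mdeg_sum: "mdeg (\<Sum>j\<in>A. f j) = (\<Sum>j\<in>A. mdeg (f j))"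
  by (induction A rule: infinite_finite_induct) (simp_all add: mdeg_add)

lemma mdeg_omit_mon: "a \<in> {1..n} \<Longrightarrow> mdeg (omit_mon n a) = n - 1"
  by (simp add: omit_mon_def mdeg_sum)

lemma mdeg_word_mon_cong:
  "length as = length bs \<Longrightarrow> set as \<subseteq> {1..n} \<Longrightarrow> set bs \<subseteq> {1..n} \<Longrightarrow>
    mdeg (word_mon n q as) = mdeg (word_mon n q bs)"
  by (induction as bs rule: list_induct2) (simp_all add: mdeg_add mdeg_omit_mon)

lemma mdeg_word_mon_add: "mdeg (word_mon n (c + q) as) = mdeg (word_mon n q as) + 2 ^ length as * mdeg c"
  by (induction as) (simp_all add: mdeg_add)

lemma mons_0 [simp]: "0 \<in> mons n"
  by (simp add: mons_def)

lemma mons_add: "a \<in> mons n \<Longrightarrow> b \<in> mons n \<Longrightarrow> a + b \<in> mons n"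
  using keys_add[of a b] by (auto simp: mons_def)

lemma mons_sum: "(\<And>j. j \<in> A \<Longrightarrow> f j \<in> mons n) \<Longrightarrow> (\<Sum>j\<in>A. f j) \<in> mons n"
  by (induction A rule: infinite_finite_induct) (simp_all add: mons_add)

lemma mons_single: "j \<in> {1..n} \<Longrightarrow> Poly_Mapping.single j m \<in> mons n"
  by (simp add: mons_def)

lemma mons_word_mon: "q \<in> mons n \<Longrightarrow> word_mon n q as \<in> mons n"
  by (induction as) (auto simp: omit_mon_def intro!: mons_add mons_sum mons_single)

definition Hom :: "nat \<Rightarrow> nat \<Rightarrow> pol set" where
  "Hom n m = {f. \<forall>b\<in>keys f. b \<in> mons n \<and> mdeg b = m}"

lemma Hom_0 [simp]: "0 \<in> Hom n m"
  by (simp add: Hom_def)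

lemma Hom_add: "f \<in> Hom n m \<Longrightarrow> g \<in> Hom n m \<Longrightarrow> f + g \<in> Hom n m"
  using keys_add[of f g] by (auto simp: Hom_def)

lemma Hom_sum: "(\<And>j. j \<in> A \<Longrightarrow> f j \<in> Hom n m) \<Longrightarrow> sum f A \<in> Hom n m"
  by (induction A rule: infinite_finite_induct) (simp_all add: Hom_add)

lemma Hom_mult: "f \<in> Hom n i \<Longrightarrow> g \<in> Hom n j \<Longrightarrow> f * g \<in> Hom n (i + j)"
  using keys_mult[of f g] by (fastforce simp: Hom_def mons_add mdeg_add)

lemma Hom_mono_pol: "a \<in> mons n \<Longrightarrow> mdeg a = m \<Longrightarrow> mono_pol a \<in> Hom n m"
  by (simp add: Hom_def)

text \<open>Hypotheses of this shape say that the coefficient of T^k raises the degree by k. They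
  hold for x_j + x_j^2 T and pass to products, hence to total squares.\<close>

lemma coeff_mult_Hom:
  assumes "\<And>k. coeff F k \<in> Hom n (i + k)" "\<And>k. coeff G k \<in> Hom n (j + k)"
  shows "coeff (F * G) k \<in> Hom n (i + j + k)"
  unfolding coeff_mult
proof (rule Hom_sum)
  fix l assume "l \<in> {..k}"
  then have "i + j + k = (i + l) + (j + (k - l))" by simp
  with Hom_mult[OF assms] show "coeff F l * coeff G (k - l) \<in> Hom n (i + j + k)"
    by metis
qed

lemma Hom_1 [simp]: "1 \<in> Hom n 0"
  using Hom_mono_pol[of 0 n 0] by simp

lemma coeff_power_Hom:
  assumes "\<And>k. coeff F k \<in> Hom n (i + k)"
  shows "coeff (F ^ e) k \<in> Hom n (e * i + k)"
proof (induction e arbitrary: k)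
  case 0
  then show ?case by simp
next
  case (Suc e)
  have "coeff (F * F ^ e) k \<in> Hom n (i + e * i + k)" by (rule coeff_mult_Hom) (fact assms Suc)+
  then show ?case by simp
qed

lemma coeff_prod_Hom:
  assumes "\<And>j k. j \<in> A \<Longrightarrow> coeff (F j) k \<in> Hom n (e j + k)"
  shows "coeff (\<Prod>j\<in>A. F j) k \<in> Hom n ((\<Sum>j\<in>A. e j) + k)"
  using assms
proof (induction A arbitrary: k rule: infinite_finite_induct)
  case (insert a A)
  then have "coeff (F a * (\<Prod>j\<in>A. F j)) k \<in> Hom n (e a + (\<Sum>j\<in>A. e j) + k)"
    by (intro coeff_mult_Hom) auto
  with insert.hyps show ?case by simp
qed (simp_all)

lemma Sq_Hom:
  assumes "a \<in> mons n"
  shows "Sq k (mono_pol a) \<in> Hom n (mdeg a + k)"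
proof -
  have "coeff [:var j, (var j)\<^sup>2:] k \<in> Hom n (1 + k)" if "j \<in> keys a" for j k
  proof -
    have "j \<in> {1..n}" using assms that by (auto simp: mons_def)
    then have "Poly_Mapping.single j m \<in> mons n" for m by (rule mons_single)
    then show ?thesis
      by (auto simp: var_def mono_pol_square coeff_pCons mdeg_add mons_add Hom_mono_pol
          split: nat.split)
  qed
  then have "coeff ([:var j, (var j)\<^sup>2:] ^ nu j a) k \<in> Hom n (nu j a + k)" if "j \<in> keys a" for j k
    using coeff_power_Hom[of "[:var j, (var j)\<^sup>2:]" n 1 "nu j a"] that by simp
  from coeff_prod_Hom[OF this, of "keys a"] show ?thesis
    by (simp add: Sq_def total_sq_mono_pol[of "keys a"] mdeg_def)
qed

section \<open>Sq^(2^i) on words ending in powers of x_1 ... x_n\<close>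

definition all_mon :: "nat \<Rightarrow> mon" where
  "all_mon n = (\<Sum>j\<in>{1..n}. Poly_Mapping.single j 1)"

lemma all_mon_omit_mon: "j \<in> {1..n} \<Longrightarrow> all_mon n = Poly_Mapping.single j 1 + omit_mon n j"
  unfolding all_mon_def omit_mon_def by (simp add: sum.remove)

lemma mono_pol_all_mon: "mono_pol (all_mon n) = (\<Prod>j\<in>{1..n}. var j)"
  by (simp add: all_mon_def mono_pol_sum var_def)

text \<open>
  \<open>fill n c m\<close> stands for the monomial with \<open>m\<close> factors \<open>x\<^sub>1 \<cdots> x\<^sub>n\<close>, raised to
  \<open>1, 2, \<dots>, 2\<^bsup>m-1\<^esup>\<close>, times \<open>c\<close> raised to \<open>2\<^sup>m\<close>; for \<open>m > 0\<close> all its exponents are odd.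
\<close>

primrec fill :: "nat \<Rightarrow> mon \<Rightarrow> nat \<Rightarrow> mon" where
  "fill n c 0 = c"
| "fill n c (Suc m) = all_mon n + (fill n c m + fill n c m)"

text \<open>Since x_j x_1 ... x_n = X_j x_j^2, an extra x_j turns each factor x_1 ... x_n into X_j
  and survives at the next power of two, until it reaches \<open>c\<close>.\<close>

lemma single_fill:
  "j \<in> {1..n} \<Longrightarrow> Poly_Mapping.single j 1 + fill n c m
    = word_mon n (Poly_Mapping.single j 1 + c) (replicate m j)"
proof (induction m)
  case (Suc m)
  then have "word_mon n (Poly_Mapping.single j 1 + c) (replicate (Suc m) j) =
      omit_mon n j + ((Poly_Mapping.single j 1 + fill n c m) + (Poly_Mapping.single j 1 + fill n c m))"
    by (simp only: replicate.simps word_mon.simps)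
  also have "\<dots> = Poly_Mapping.single j 1 + ((Poly_Mapping.single j 1 + omit_mon n j)
      + (fill n c m + fill n c m))"
    by (simp only: add_ac)
  finally show ?case using all_mon_omit_mon[OF Suc.prems] by (simp only: fill.simps)
qed simp

lemma Sq_1_fill:
  assumes "0 < m"
  shows "Sq 1 (mono_pol (fill n c m)) = (\<Sum>j\<in>{1..n}. mono_pol (Poly_Mapping.single j 1 + fill n c m))"
proof -
  obtain m' where m: "m = Suc m'" using assms by (cases m) auto
  let ?Q = "(mono_pol (fill n c m'))\<^sup>2"
  have fill: "mono_pol (fill n c m) = mono_pol (all_mon n) * ?Q"
    by (simp only: m fill.simps mono_pol_add power2_eq_square)
  have "Sq 1 (mono_pol (fill n c m)) = Sq 1 (mono_pol (all_mon n)) * ?Q"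
    unfolding fill Sq_1_mult Sq_1_square by simp
  also have "\<dots> = (\<Sum>j\<in>{1..n}. var j * (mono_pol (all_mon n) * ?Q))"
    by (simp only: mono_pol_all_mon Sq_1_prod_var finite_atLeastAtMost sum_distrib_right mult.assoc)
  finally show ?thesis by (simp only: fill [symmetric] mono_pol_add var_def)
qed

text \<open>Modulo lower weight the letters of \<open>as\<close> act as constants, so only the tail,
  a 2^i-th power with i = \<open>length as\<close>, is hit, and there Sq^(2^i) acts as Sq^1.\<close>

lemma Sq_word_fill:
  assumes "set as \<subseteq> {1..n}" "0 < m"
  shows "\<exists>l\<in>Low n (length as). Sq (2 ^ length as) (mono_pol (word_mon n (fill n c m) as))
    = (\<Sum>j\<in>{1..n}. mono_pol (word_mon n (Poly_Mapping.single j 1 + c) (as @ replicate m j))) + l"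
proof -
  let ?i = "length as" and ?w = "mono_pol (word_mon n 0 as)"
  let ?H = "total_sq (mono_pol (fill n c m))"
  obtain L where L: "total_sq ?w * ?H ^ 2 ^ ?i = [:?w:] * ?H ^ 2 ^ ?i + L"
    "\<And>k. coeff L k \<in> Low n ?i"
    using total_sq_word_low[OF assms(1)] by blast
  have "Sq (2 ^ ?i) (mono_pol (word_mon n (fill n c m) as)) = coeff (total_sq ?w * ?H ^ 2 ^ ?i) (2 ^ ?i)"
    by (subst mono_pol_word_mon) (simp add: Sq_def total_sq_mult total_sq_power)
  also have "\<dots> = ?w * (Sq 1 (mono_pol (fill n c m))) ^ 2 ^ ?i + coeff L (2 ^ ?i)"
    unfolding L by (simp add: coeff_power_two Sq_def)
  also have "?w * (Sq 1 (mono_pol (fill n c m))) ^ 2 ^ ?i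
      = (\<Sum>j\<in>{1..n}. ?w * mono_pol (Poly_Mapping.single j 1 + fill n c m) ^ 2 ^ ?i)"
    by (simp only: Sq_1_fill[OF assms(2)] pol_sum_power_two sum_distrib_left)
  also have "\<dots> = (\<Sum>j\<in>{1..n}. mono_pol (word_mon n (Poly_Mapping.single j 1 + c) (as @ replicate m j)))"
  proof (rule sum.cong)
    fix j assume "j \<in> {1..n}"
    then show "?w * mono_pol (Poly_Mapping.single j 1 + fill n c m) ^ 2 ^ ?i
        = mono_pol (word_mon n (Poly_Mapping.single j 1 + c) (as @ replicate m j))"
      by (simp only: word_mon_append single_fill flip: mono_pol_word_mon)
  qed simp
  finally show ?thesis using L(2) by blast
qed

section \<open>The equivalence relation on words and its rewriting rules\<close>

definition word_rel :: "nat \<Rightarrow> nat \<Rightarrow> mon \<Rightarrow> nat list \<Rightarrow> nat list \<Rightarrow> bool" where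
  "word_rel n s q as bs \<longleftrightarrow>
     length as = length bs \<and> set as \<subseteq> {1..n} \<and> set bs \<subseteq> {1..n} \<and>
     (\<exists>f\<in>SqP s n. \<exists>g\<in>Low n (length as) \<inter> Hom n (mdeg (word_mon n q as)).
        mono_pol (word_mon n q as) + mono_pol (word_mon n q bs) = f + g)"

lemma word_rel_refl: "set as \<subseteq> {1..n} \<Longrightarrow> word_rel n s q as as"
  unfolding word_rel_def SqP_def
  by (auto intro!: bexI[of _ 0] F2.span_zero)

text \<open>The remainders depend on the left word only through its length and degree, which related
  words share. The sum of the two words is their difference over F_2.\<close>

lemma word_rel_sym: "word_rel n s q as bs \<Longrightarrow> word_rel n s q bs as"
  unfolding word_rel_def by (metis mdeg_word_mon_cong add.commute)

lemma word_rel_trans [trans]: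
  assumes "word_rel n s q as bs" "word_rel n s q bs cs"
  shows "word_rel n s q as cs"
proof -
  let ?D = "Low n (length as) \<inter> Hom n (mdeg (word_mon n q as))"
  let ?m = "\<lambda>as. mono_pol (word_mon n q as)"
  have len: "length as = length bs" and sub: "set as \<subseteq> {1..n}" "set bs \<subseteq> {1..n}"
    using assms by (auto simp: word_rel_def)
  obtain f g where 1: "f \<in> SqP s n" "g \<in> ?D" "?m as + ?m bs = f + g"
    using assms(1) by (auto simp: word_rel_def)
  have deg: "mdeg (word_mon n q as) = mdeg (word_mon n q bs)"
    by (rule mdeg_word_mon_cong[OF len sub])
  obtain f' g' where 2: "f' \<in> SqP s n" "g' \<in> ?D" "?m bs + ?m cs = f' + g'"
    using assms(2) unfolding word_rel_def len deg by blast
  have "?m as + ?m cs = (?m as + (?m bs + ?m bs)) + ?m cs" by (simp only: pol_add_self add_0_right)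
  also have "\<dots> = (?m as + ?m bs) + (?m bs + ?m cs)" by (simp only: add_ac)
  also have "\<dots> = (f + f') + (g + g')" unfolding 1 2 by (simp only: add_ac)
  finally have "?m as + ?m cs = (f + f') + (g + g')" .
  moreover have "f + f' \<in> SqP s n" using 1 2 by (simp add: SqP_def F2.span_add)
  moreover have "g + g' \<in> ?D" using 1 2 by (auto intro: Low_add Hom_add)
  ultimately show ?thesis using assms unfolding word_rel_def by auto
qed

text \<open>Apply Sq^(2^i), i = \<open>length as\<close>, to \<open>as\<close> followed by m factors
  x_1 ... x_n and then \<open>c\<close>, chosen with x_a c = X_b q^2 and x_b c = X_a q^2. In the
  resulting sum of words over j, the terms j = a and j = b are the two sides; any other j falls
  below n - 1 at position i + m or earlier.\<close>

lemma word_rel_exchange: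
  assumes as: "set as \<subseteq> {1..n}" "length as < s" and ab: "a \<in> {1..n}" "b \<in> {1..n}"
    and m: "0 < m" and bs: "set bs \<subseteq> {1..n}" and x: "x \<in> mons n"
  shows "word_rel n s x (as @ replicate m a @ b # bs) (as @ replicate m b @ a # bs)"
proof (cases "a = b")
  case True
  have "set (as @ replicate m a @ b # bs) \<subseteq> {1..n}" using as ab bs by (auto simp del: One_nat_def)
  with True show ?thesis by (simp only: word_rel_refl)
next
  case False
  let ?i = "length as"
  define q where "q = word_mon n x bs"
  have q: "q \<in> mons n" using x by (simp add: q_def mons_word_mon)
  define e where "e = (\<Sum>j\<in>{1..n} - {a, b}. Poly_Mapping.single j (1 :: nat))"
  have nu_e: "nu j e = (if j \<in> {1..n} - {a, b} then 1 else 0)" for j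
    by (simp add: e_def lookup_sum lookup_single when_def)
  define c where "c = e + (q + q)"
  have c: "c \<in> mons n"
    using q by (auto simp: c_def e_def intro!: mons_add mons_sum mons_single)
  have omit: "Poly_Mapping.single a 1 + c = omit_mon n b + (q + q)"
    if "a \<in> {1..n}" "a \<noteq> b" "e = (\<Sum>j\<in>{1..n} - {a, b}. Poly_Mapping.single j (1 :: nat))" for a b
  proof -
    have "omit_mon n b = Poly_Mapping.single a 1 + e"
      unfolding omit_mon_def that(3) using that(1,2)
      by (subst sum.remove[of _ a]) (auto intro!: arg_cong2[where f = "(+)"] sum.cong)
    then show ?thesis by (simp only: c_def add.assoc)
  qed
  define M where "M j = word_mon n (Poly_Mapping.single j 1 + c) (as @ replicate m j)" for j
  have Ma: "M a = word_mon n x (as @ replicate m a @ b # bs)"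
    unfolding M_def omit[OF ab(1) False e_def] by (simp only: word_mon_append word_mon.simps q_def)
  have e': "e = (\<Sum>j\<in>{1..n} - {b, a}. Poly_Mapping.single j (1 :: nat))"
    by (simp add: e_def insert_commute)
  have Mb: "M b = word_mon n x (as @ replicate m b @ a # bs)"
    unfolding M_def omit[OF ab(2) not_sym[OF False] e']
    by (simp only: word_mon_append word_mon.simps q_def)
  define z where "z = word_mon n (fill n c m) as"
  have fill: "fill n c m \<in> mons n"
    using c by (induction m) (auto simp: all_mon_def intro!: mons_add mons_sum mons_single)
  then have z: "z \<in> mons n" by (simp add: z_def mons_word_mon)
  have M: "M j \<in> mons n" "mdeg (M j) = mdeg z + 2 ^ ?i" if "j \<in> {1..n}" for j
  proof -
    have "M j = word_mon n (Poly_Mapping.single j 1 + fill n c m) as"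
      using that by (simp only: M_def word_mon_append single_fill)
    then show "M j \<in> mons n" "mdeg (M j) = mdeg z + 2 ^ ?i"
      using that fill
      by (simp_all add: z_def mdeg_word_mon_add mons_word_mon mons_add mons_single del: One_nat_def)
  qed
  obtain l where l: "l \<in> Low n ?i" "Sq (2 ^ ?i) (mono_pol z) = (\<Sum>j\<in>{1..n}. mono_pol (M j)) + l"
    using Sq_word_fill[OF as(1) m] unfolding z_def M_def by blast
  let ?R = "\<Sum>j\<in>{1..n} - {a, b}. mono_pol (M j)"
  have "(\<Sum>j\<in>{1..n}. mono_pol (M j)) = mono_pol (M a) + (mono_pol (M b) + ?R)"
    using ab False by (simp add: sum.remove[of _ a] sum.remove[of _ b] Diff_insert2 [symmetric] insert_commute)
  then have S: "Sq (2 ^ ?i) (mono_pol z) = (mono_pol (M a) + mono_pol (M b)) + (?R + l)"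
    unfolding l(2) by (simp only: add.assoc)
  then have eq: "mono_pol (M a) + mono_pol (M b) = Sq (2 ^ ?i) (mono_pol z) + (?R + l)"
    unfolding S by (simp only: add.assoc pol_add_self add_0_right)
  have hom: "Sq (2 ^ ?i) (mono_pol z) \<in> Hom n (mdeg (M a))"
    using Sq_Hom[OF z] M(2)[OF ab(1)] by simp
  \<comment> \<open>The degree of \<open>l\<close> is not known separately; the sum is homogeneous
    as a difference of homogeneous polynomials.\<close>
  have "?R + l = Sq (2 ^ ?i) (mono_pol z) + (mono_pol (M a) + mono_pol (M b))"
    unfolding S by (simp only: add_ac) (simp only: pol_add_self add_0_right flip: add.assoc)
  then have "?R + l \<in> Hom n (mdeg (M a))"
    using hom M ab by (simp add: Hom_add Hom_mono_pol)
  moreover have "?R + l \<in> Low n (?i + m + 1)"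
  proof (intro Low_add Low_sum)
    fix j assume j: "j \<in> {1..n} - {a, b}"
    have "wt n (Poly_Mapping.single j 1 + c) 0 = wt n (Poly_Mapping.single j 1 + e) 0"
      unfolding c_def add.assoc [symmetric] unfolding add.assoc[of _ q q] wt_0_add_double ..
    \<comment> \<open>Here x_a and x_b have exponent 0 and x_j has exponent 2, so three variables
      lack an odd exponent.\<close>
    also have "\<dots> = (\<Sum>k\<in>{1..n} - {a, b, j}. 1)"
      unfolding wt_def using j
      by (intro sum.mono_neutral_cong_right)
        (auto simp: lookup_add nu_e lookup_single when_def digit_def)
    also have "\<dots> = card ({1..n} - {a, b, j})" by simp
    also have "\<dots> < card ({1..n} - {a})"
    proof (rule psubset_card_mono)
      show "{1..n} - {a, b, j} \<subset> {1..n} - {a}" using ab False by blast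
    qed simp
    also have "card ({1..n} - {a}) = n - 1"
      using ab by simp
    finally have "low n 1 (Poly_Mapping.single j 1 + c)"
      by (rule low_wt_0) simp
    then have "low n (length (as @ replicate m j) + 1) (M j)"
      unfolding M_def using as j by (intro low_word_mon) auto
    then show "mono_pol (M j) \<in> Low n (?i + m + 1)" by (simp add: Low_def)
  next
    show "l \<in> Low n (?i + m + 1)" using l(1) low_mono[of n ?i _ "?i + m + 1"] by (auto simp: Low_def)
  qed
  then have "?R + l \<in> Low n (length (as @ replicate m a @ b # bs))"
    using low_mono[of n "?i + m + 1" _ "length (as @ replicate m a @ b # bs)"] by (auto simp: Low_def)
  moreover have "Sq (2 ^ ?i) (mono_pol z) \<in> SqP s n"
    unfolding SqP_def using as(2) z
    by (intro F2.span_base) (auto simp: P_def intro!: exI[of _ "2 ^ ?i"] exI[of _ "mono_pol z"])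
  ultimately show ?thesis
    using eq as ab bs unfolding word_rel_def Ma Mb by auto
qed

text \<open>Adjacent letters swap by an exchange with a block of length 1. The last swap starts at
  position \<open>length as + length bs - 1\<close>, which explains the bound by
  \<open>s\<close>.\<close>

lemma word_rel_move:
  assumes "set (as @ a # bs @ cs) \<subseteq> {1..n}" "length as + length bs \<le> s" "x \<in> mons n"
  shows "word_rel n s x (as @ a # bs @ cs) (as @ bs @ a # cs)"
  using assms
proof (induction bs arbitrary: as)
  case Nil
  then show ?case by (simp add: word_rel_refl)
next
  case (Cons b bs)
  have "word_rel n s x (as @ replicate 1 a @ b # bs @ cs) (as @ replicate 1 b @ a # bs @ cs)"
    using Cons.prems by (intro word_rel_exchange) auto
  also have "word_rel n s x (as @ replicate 1 b @ a # bs @ cs) (as @ (b # bs) @ a # cs)"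
    using Cons.IH[of "as @ [b]"] Cons.prems by simp
  finally show ?case by simp
qed

text \<open>The letters h are converted from left to right. Each one converted lengthens the block
  of t before the next, so \<open>step\<close> is needed for k, ..., k + u - 1.\<close>

lemma word_rel_replace_block:
  assumes step: "\<And>k rest. k < c \<Longrightarrow> set rest \<subseteq> {1..n} \<Longrightarrow>
      word_rel n s x (as @ replicate (Suc k) t @ h # rest) (as @ replicate (Suc k) t @ t # rest)"
    and "k + u \<le> c" and sub: "set as \<subseteq> {1..n}" "set rest \<subseteq> {1..n}" "t \<in> {1..n}" "h \<in> {1..n}"
  shows "word_rel n s x (as @ replicate (Suc k) t @ replicate u h @ rest)
     (as @ replicate (Suc k + u) t @ rest)"
  using assms(2)
proof (induction u arbitrary: k)
  case 0
  have "set (as @ replicate (Suc k) t @ rest) \<subseteq> {1..n}" using sub by auto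
  then show ?case using word_rel_refl by simp
next
  case (Suc u)
  have "word_rel n s x (as @ replicate (Suc k) t @ h # replicate u h @ rest)
      (as @ replicate (Suc k) t @ t # replicate u h @ rest)"
    using Suc.prems sub by (intro step) auto
  also have "as @ replicate (Suc k) t @ t # replicate u h @ rest
      = as @ replicate (Suc (Suc k)) t @ replicate u h @ rest"
    by (simp add: replicate_app_Cons_same)
  also have "word_rel n s x \<dots> (as @ replicate (Suc (Suc k) + u) t @ rest)"
    using Suc.prems by (intro Suc.IH) simp
  finally show ?case by simp
qed

text \<open>A letter h of \<open>as\<close> is brought to the end of \<open>as\<close>; then
  exchanges give h t^(c+1) h -> h^(c+2) t -> t^(c+2) h -> t h^(c+1) t -> h t h^c t, where powers
  denote repeated letters. The first h returns to its place, and the other c are converted by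
  induction. No exchange starts beyond position \<open>length as\<close>, which is below
  \<open>s\<close>.\<close>

lemma word_rel_replace:
  assumes "h \<in> set as" "set as \<subseteq> {1..n}" "length as < s" "t \<in> {1..n}" "set rest \<subseteq> {1..n}"
    and x: "x \<in> mons n"
  shows "word_rel n s x (as @ replicate (Suc c) t @ h # rest) (as @ replicate (Suc c) t @ t # rest)"
  using \<open>set rest \<subseteq> {1..n}\<close>
proof (induction c arbitrary: rest rule: less_induct)
  case (less c)
  obtain A B where as: "as = A @ h # B" using assms(1) by (meson split_list)
  note sub = assms(2,4) less.prems
  have "as @ replicate (Suc c) t @ h # rest = A @ h # B @ (replicate (Suc c) t @ h # rest)"
    by (simp add: as)
  also have "word_rel n s x \<dots> (A @ B @ h # (replicate (Suc c) t @ h # rest))"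
    using sub assms(3) x by (intro word_rel_move) (auto simp: as)
  also have "A @ B @ h # (replicate (Suc c) t @ h # rest)
      = (A @ B @ [h]) @ replicate (Suc c) t @ h # rest"
    by simp
  also have "word_rel n s x \<dots> ((A @ B @ [h]) @ replicate (Suc c) h @ t # rest)"
    using sub assms(3) x by (intro word_rel_exchange) (auto simp: as)
  also have "(A @ B @ [h]) @ replicate (Suc c) h @ t # rest
      = (A @ B) @ replicate (Suc (Suc c)) h @ t # rest"
    by simp
  also have "word_rel n s x \<dots> ((A @ B) @ replicate (Suc (Suc c)) t @ h # rest)"
    using sub assms(3) x by (intro word_rel_exchange) (auto simp: as)
  also have "(A @ B) @ replicate (Suc (Suc c)) t @ h # rest
      = (A @ B @ [t]) @ replicate (Suc c) t @ h # rest"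
    by simp
  also have "word_rel n s x \<dots> ((A @ B @ [t]) @ replicate (Suc c) h @ t # rest)"
    using sub assms(3) x by (intro word_rel_exchange) (auto simp: as)
  also have "(A @ B @ [t]) @ replicate (Suc c) h @ t # rest
      = (A @ B) @ replicate 1 t @ h # (replicate c h @ t # rest)"
    by simp
  also have "word_rel n s x \<dots> ((A @ B) @ replicate 1 h @ t # (replicate c h @ t # rest))"
    using sub assms(3) x by (intro word_rel_exchange) (auto simp: as)
  also have "(A @ B) @ replicate 1 h @ t # (replicate c h @ t # rest)
      = A @ B @ h # (t # replicate c h @ t # rest)"
    by simp
  also have "word_rel n s x \<dots> (A @ h # B @ (t # replicate c h @ t # rest))"
    using sub assms(3) x by (intro word_rel_sym[OF word_rel_move]) (auto simp: as)
  also have "A @ h # B @ (t # replicate c h @ t # rest)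
      = as @ replicate (Suc 0) t @ replicate c h @ (t # rest)"
    by (simp add: as)
  \<comment> \<open>The c letters h are met behind blocks of t of lengths 1, ..., c, each shorter
    than the block of length c + 1 in question.\<close>
  also have "word_rel n s x \<dots> (as @ replicate (Suc 0 + c) t @ (t # rest))"
    using sub assms(1) by (intro word_rel_replace_block[of c] less.IH) auto
  finally show ?case by simp
qed

section \<open>The values of \<open>phi\<close> as words\<close>

lemma mono_pol_single_power: "mono_pol (Poly_Mapping.single j m) = var j ^ m"
proof (induction m)
  case (Suc m)
  have "Poly_Mapping.single j (Suc m) = Poly_Mapping.single j 1 + Poly_Mapping.single j m"
    by (simp flip: single_add)
  with Suc show ?case by (simp add: mono_pol_add var_def)
qed simp

lemma inj_mono_pol: "mono_pol a = mono_pol b \<Longrightarrow> a = b"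
  by (metis keys_mono_pol singleton_inject)

lemma mono_pol_word_mon_replicate:
  "mono_pol (word_mon n q (replicate k a)) = X_omit n a ^ (2 ^ k - 1) * mono_pol q ^ 2 ^ k"
proof (induction k)
  case (Suc k)
  have *: "(2 :: nat) ^ Suc k - 1 = 1 + 2 * (2 ^ k - 1)"
    using one_le_power[of "2 :: nat" k] unfolding power_Suc by linarith
  show ?case
    unfolding replicate.simps mono_pol_word_mon_Cons Suc * power_add power_mult power_mult_distrib
    by (simp add: mult.commute[of 2] power_mult flip: power_mult)
qed simp

text \<open>Each X_a times its missing x_a is x_1 ... x_n. This reads the quotient of a power of x_1
  ... x_n by a monomial such as x_(I,1) as a word.\<close>

lemma mono_pol_word_mon_mult:
  assumes "set as \<subseteq> {1..n}"
  shows "mono_pol (word_mon n 0 as) * (\<Prod>k<length as. var (as ! k) ^ 2 ^ k)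
    = (\<Prod>j\<in>{1..n}. var j) ^ (2 ^ length as - 1)"
  using assms
proof (induction as)
  case (Cons a as)
  let ?E = "\<Prod>j\<in>{1..n}. var j"
  have a: "a \<in> {1..n}" using Cons.prems by simp
  have E: "?E = var a * X_omit n a"
    unfolding X_omit_def using a by (simp add: prod.remove)
  have *: "(2 :: nat) ^ length (a # as) - 1 = 1 + (2 ^ length as - 1) * 2"
    using one_le_power[of "2 :: nat" "length as"] unfolding length_Cons power_Suc by linarith
  have "(\<Prod>k<length (a # as). var ((a # as) ! k) ^ 2 ^ k)
      = var a * (\<Prod>k<length as. var (as ! k) ^ 2 ^ k)\<^sup>2"
    unfolding length_Cons prod.lessThan_Suc_shift
    by (simp add: prod_power_distrib mult.commute flip: power_mult)
  then have "mono_pol (word_mon n 0 (a # as)) * (\<Prod>k<length (a # as). var ((a # as) ! k) ^ 2 ^ k)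
      = (var a * X_omit n a) * (mono_pol (word_mon n 0 as) * (\<Prod>k<length as. var (as ! k) ^ 2 ^ k))\<^sup>2"
    unfolding mono_pol_word_mon_Cons by (simp only: power_mult_distrib mult_ac)
  also have "\<dots> = ?E * (?E ^ (2 ^ length as - 1))\<^sup>2"
    using Cons by (simp only: E [symmetric]) simp
  also have "\<dots> = ?E ^ (2 ^ length (a # as) - 1)"
    unfolding * power_add power_mult by simp
  finally show ?case .
qed simp

lemma digit_mask: "i < e \<Longrightarrow> digit i (2 ^ e - 1) = 1"
  using bit_mask_iff[of e i, where ?'a = nat]
  by (simp add: digit_def bit_iff_odd mask_eq_exp_minus_1 odd_iff_mod_2_eq_one)

text \<open>With r = n - t all exponents are 2^e - 1 > 2^r - 1, so v = 1 and the value is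
  x_t^(2^r-1) X_t^(2^e-1) / x_(I,1). Its part (x_1 ... x_n)^(2^r-1) / x_(I,1) is the word n, ...,
  t+1, and X_t^(2^e-2^r) supplies e - r letters t.\<close>

lemma phi_X_all_power:
  assumes "1 \<le> t" "t < n" "n - t < e"
  shows "phi t [t+1..<n+1] (X_all (n - 1) ^ (2 ^ e - 1))
    = mono_pol (word_mon n 0 (rev [t+1..<n+1] @ replicate (e - (n - t)) t))"
proof -
  define r where "r = n - t"
  define I where "I = [t+1..<n+1]"
  define a where "a = (\<Sum>j\<in>{1..n-1}. Poly_Mapping.single j (2 ^ e - 1 :: nat))"
  have r: "1 \<le> r" "r < e" "length I = r" using assms by (auto simp: r_def I_def)
  have I: "set I \<subseteq> {1..n}" using assms by (auto simp: I_def simp del: upt_Suc)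
  have entry: "entry I k = t + k" if "k \<in> {1..r}" for k
    using that by (auto simp: I_def r_def nth_append simp del: upt_Suc)
  have X: "X_all (n - 1) ^ (2 ^ e - 1) = mono_pol a"
    by (simp add: X_all_def a_def mono_pol_sum mono_pol_single_power prod_power_distrib)
  have nu: "nu j a = (if j \<in> {1..n-1} then 2 ^ e - 1 else 0)" for j
    by (simp add: a_def lookup_sum lookup_single when_def)
  have "bij_betw (shift_index t) {1..n-1} ({1..n} - {t})"
    by (rule bij_betw_byWitness[where f' = "\<lambda>j. if j < t then j else j - 1"])
      (use assms in \<open>auto simp: shift_index_def\<close>)
  then have "(\<Sum>j\<in>{1..n-1}. Poly_Mapping.single (shift_index t j) (2 ^ e - 1 :: nat))
      = (\<Sum>j\<in>{1..n} - {t}. Poly_Mapping.single j (2 ^ e - 1))"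
    by (rule sum.reindex_bij_betw)
  moreover have "shift_mon t a = (\<Sum>j\<in>{1..n-1}. Poly_Mapping.single (shift_index t j) (nu j a))"
    by (rule shift_mon_superset) (auto simp: in_keys_iff nu split: if_splits)
  ultimately have shift: "shift_mon t a = (\<Sum>j\<in>{1..n} - {t}. Poly_Mapping.single j (2 ^ e - 1))"
    by (simp add: nu)
  have nu_I: "nu (entry I k - 1) a = 2 ^ e - 1" if "k \<in> {1..r}" for k
    using that entry[OF that] assms by (auto simp: nu r_def)
  have gt: "(2 :: nat) ^ r - 1 < 2 ^ e - 1"
    using r by (simp add: diff_less_mono)
  have comp: "compatible 1 I a"
    unfolding compatible_def Let_def r(3)
  proof (intro conjI ballI)
    show "2 ^ r - 1 < nu (entry I 1 - 1) a" using nu_I[of 1] r gt by simp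
    fix k assume "k \<in> {1..1 :: nat}"
    moreover have "nu (entry I 1 - 1) a = 2 ^ e - 1" by (rule nu_I) (use r in simp)
    ultimately show "digit (r - k) (nu (entry I 1 - 1) a) = 1"
      using digit_mask[of "r - k" e] r by simp
  next
    fix k assume "k \<in> {1<..r}"
    then show "digit (r - k) (nu (entry I k - 1) a) = 1"
      using nu_I[of k] digit_mask[of "r - k" e] r by simp
  qed (use r in auto)
  let ?as = "rev I" and ?W = "word_mon n 0 (rev I @ replicate (e - r) t)"
  have x_I: "x_Iv I 1 = (\<Sum>k\<in>{1..r}. Poly_Mapping.single (entry I k) (2 ^ (r - k)))"
    using r(1) unfolding x_Iv_def Let_def r(3) by (simp add: sum.head)
  have "mono_pol (x_Iv I 1) = (\<Prod>k\<in>{1..r}. var (entry I k) ^ 2 ^ (r - k))"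
    unfolding x_I by (simp add: mono_pol_sum mono_pol_single_power)
  \<comment> \<open>Reversing the list matches the exponents 2^(r-k) with the positions in a
    word.\<close>
  also have "\<dots> = (\<Prod>k<r. var (rev I ! k) ^ 2 ^ k)"
    by (rule prod.reindex_bij_witness[of _ "\<lambda>k. r - k" "\<lambda>k. r - k"])
      (auto simp: rev_nth r(3))
  finally have "mono_pol (word_mon n 0 ?as) * mono_pol (x_Iv I 1) = (\<Prod>j\<in>{1..n}. var j) ^ (2 ^ r - 1)"
    using mono_pol_word_mon_mult[of ?as n] I r(3) by simp
  also have "(\<Prod>j\<in>{1..n}. var j) = var t * X_omit n t"
    unfolding X_omit_def using assms by (simp add: prod.remove)
  finally have low: "mono_pol (word_mon n 0 ?as) * mono_pol (x_Iv I 1)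
      = var t ^ (2 ^ r - 1) * X_omit n t ^ (2 ^ r - 1)"
    by (simp only: power_mult_distrib)
  have W: "mono_pol ?W = mono_pol (word_mon n 0 ?as) * (X_omit n t ^ (2 ^ (e - r) - 1)) ^ 2 ^ r"
    unfolding word_mon_append by (subst mono_pol_word_mon) (simp add: mono_pol_word_mon_replicate r(3))
  have e: "(2 :: nat) ^ e - 1 = (2 ^ r - 1) + (2 ^ (e - r) - 1) * 2 ^ r"
  proof -
    have "(2 :: nat) ^ e = 2 ^ (e - r) * 2 ^ r" using r by (simp flip: power_add)
    moreover have "(1 :: nat) \<le> 2 ^ r" "(1 :: nat) \<le> 2 ^ (e - r)" by simp_all
    ultimately show ?thesis by (simp add: diff_mult_distrib)
  qed
  \<comment> \<open>The quotient is verified as a product and then cancelled on exponents, where the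
    truncated difference is exact.\<close>
  have "mono_pol (?W + x_Iv I 1)
      = (mono_pol (word_mon n 0 ?as) * mono_pol (x_Iv I 1)) * (X_omit n t ^ (2 ^ (e - r) - 1)) ^ 2 ^ r"
    unfolding mono_pol_add W by (simp only: mult_ac)
  also have "\<dots> = var t ^ (2 ^ r - 1) * X_omit n t ^ (2 ^ e - 1)"
    unfolding low e power_add power_mult by (simp only: mult_ac)
  also have "\<dots> = mono_pol (Poly_Mapping.single t (2 ^ r - 1) + shift_mon t a)"
    by (simp add: shift mono_pol_add mono_pol_sum mono_pol_single_power X_omit_def prod_power_distrib)
  finally have "Poly_Mapping.single t (2 ^ r - 1) + shift_mon t a = ?W + x_Iv I 1"
    by (rule inj_mono_pol[OF sym])
  then have "Poly_Mapping.single t (2 ^ r - 1) + shift_mon t a - x_Iv I 1 = ?W" by simp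
  moreover have "I \<noteq> []" using r by auto
  ultimately show ?thesis
    unfolding I_def [symmetric] r_def [symmetric] X phi_def
    using comp the_compatible[OF comp] by (auto simp: phi_mon_def r(3))
qed

section \<open>Weight vectors, and the passage from \<open>word_rel\<close> to
  \<open>equiv_mon\<close>\<close>

lemma sum_digits: "(\<Sum>i<N. 2 ^ i * digit i a) = a mod 2 ^ N"
proof (induction N)
  case (Suc N)
  then show ?case using mod_mult2_eq[of a "2 ^ N" 2] by (simp add: digit_def mult.commute)
qed simp

lemma weight_deg_weight: "weight_deg (weight z) = mdeg z"
proof -
  obtain N where N: "keys (weight z) \<subseteq> {..<N}" using finite_nat_bounded finite_keys by blast
  define M where "M = max N (mdeg z)"
  have "weight_deg (weight z) = (\<Sum>i<M. 2 ^ i * lookup (weight z) i)"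
    unfolding weight_deg_def using N
    by (intro sum.mono_neutral_left) (auto simp: M_def in_keys_iff)
  also have "\<dots> = (\<Sum>j\<in>keys z. \<Sum>i<M. 2 ^ i * digit i (nu j z))"
    unfolding lookup_weight sum_distrib_left by (rule sum.swap)
  also have "\<dots> = (\<Sum>j\<in>keys z. nu j z)"
  proof (rule sum.cong)
    fix j assume "j \<in> keys z"
    then have "nu j z \<le> mdeg z" unfolding mdeg_def by (intro member_le_sum) auto
    also have "\<dots> \<le> M" by (simp add: M_def)
    also have "M < 2 ^ M" by (rule less_exp)
    finally show "(\<Sum>i<M. 2 ^ i * digit i (nu j z)) = nu j z" by (simp add: sum_digits)
  qed simp
  finally show ?thesis by (simp add: mdeg_def)
qed

lemma lookup_weight_wt: "b \<in> mons n \<Longrightarrow> lookup (weight b) k = wt n b k"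
  unfolding lookup_weight wt_def
  by (intro sum.mono_neutral_left) (auto simp: mons_def in_keys_iff digit_def)

text \<open>The first defect of a low monomial lies below \<open>d\<close>, where \<open>z\<close>
  has n - 1 in every position, so it decides the lexicographic order.\<close>

lemma Low_Hom_P_minus:
  assumes "f \<in> Low n d" "f \<in> Hom n (mdeg z)" "z \<in> mons n" "\<And>k. k < d \<Longrightarrow> wt n z k = n - 1"
  shows "f \<in> P_minus n (weight z)"
proof -
  have "mono_pol b \<in> P_minus n (weight z)" if "b \<in> keys f" for b
  proof -
    have b: "b \<in> mons n" "mdeg b = mdeg z" "low n d b"
      using assms that by (auto simp: Low_def Hom_def)
    then obtain k where k: "k < d" "wt n b k < n - 1" "\<And>l. l < k \<Longrightarrow> wt n b l = n - 1"
      by (auto simp: low_def)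
    then have "lookup (weight b) k < lookup (weight z) k \<and>
        (\<forall>l<k. lookup (weight b) l = lookup (weight z) l)"
      using assms(3,4) b by (simp add: lookup_weight_wt)
    then have "weight b < weight z" unfolding weight_less_iff by blast
    then show ?thesis
      unfolding P_minus_def weight_deg_weight using b by (intro F2.span_base) auto
  qed
  then have "(\<Sum>b\<in>keys f. mono_pol b) \<in> P_minus n (weight z)"
    unfolding P_minus_def by (intro F2.span_sum) auto
  then show ?thesis by (subst pol_eq_sum_mono_pol[of f])
qed

lemma word_rel_imp_equiv_mon:
  assumes "word_rel n s x as bs" "x \<in> mons n"
  shows "equiv_mon n s (mono_pol (word_mon n x as)) (mono_pol (word_mon n x bs))"
proof -
  let ?f = "mono_pol (word_mon n x as)" and ?g = "mono_pol (word_mon n x bs)"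
  let ?z = "word_mon n x as"
  have rel: "length as = length bs" "set as \<subseteq> {1..n}" "set bs \<subseteq> {1..n}"
    using assms(1) by (auto simp: word_rel_def)
  obtain a b where ab: "a \<in> SqP s n" "b \<in> Low n (length as)" "b \<in> Hom n (mdeg ?z)" "?f + ?g = a + b"
    using assms(1) by (auto simp: word_rel_def)
  have "b \<in> P_minus n (weight ?z)"
    using ab rel assms(2) by (intro Low_Hom_P_minus) (auto simp: mons_word_mon wt_word_mon)
  moreover have "?f - ?g = ?f + ?g"
    by (simp add: diff_eq_eq add.assoc)
  ultimately have "?f - ?g \<in> {a + b |a b. a \<in> SqP s n \<and> b \<in> P_minus n (weight ?z)}"
    using ab by auto
  moreover have "homogeneous (mdeg ?z) ?f \<and> homogeneous (mdeg ?z) ?g"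
    using mdeg_word_mon_cong[OF rel] by (simp add: homogeneous_def)
  ultimately show ?thesis
    unfolding equiv_mon_def equiv_w_def using assms(2) by (auto simp: P_def mons_word_mon)
qed

section \<open>Both sides of the equivalence as words\<close>

theorem proposition3p10:
  fixes n d h t u :: nat and x :: mon
  assumes "1 \<le> u" and "int u < int d - int n + int t"
    and "0 < t" and "t < h" and "h \<le> n"
    and "x \<in> mons n"
  shows "equiv_mon n (n - t + 1)
           (phi t [t+1..<n+1] (X_all (n - 1) ^ (2 ^ (d - u) - 1))
              * X_omit n h ^ (2 ^ d - 2 ^ (d - u)) * mono_pol x ^ (2 ^ d))
           (phi t [t+1..<n+1] (X_all (n - 1) ^ (2 ^ d - 1)) * mono_pol x ^ (2 ^ d))"
proof -
  let ?as = "rev [t+1..<n+1]"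
  define r where "r = n - t"
  define e where "e = d - u"
  \<comment> \<open>The bound on u says d - u > n - t, so the left word has at least one t after its
    first n - t letters.\<close>
  obtain c where c: "e - r = Suc c"
    using assms by (cases "e - r") (auto simp: e_def r_def)
  have e: "r < e" "d = e + u" "d - r = Suc c + u" "n - t < d"
    using assms c by (auto simp: e_def r_def)
  have as: "set ?as \<subseteq> {1..n}" "length ?as = r" "h \<in> set ?as"
    using assms by (auto simp: r_def simp del: upt_Suc)
  have phi: "phi t [t+1..<n+1] (X_all (n - 1) ^ (2 ^ k - 1))
      = mono_pol (word_mon n 0 (?as @ replicate (k - r) t))" if "r < k" for k
    using phi_X_all_power[of t n k] assms that unfolding r_def by simp
  \<comment> \<open>The bounds t < h and h \<le> n put h among the letters of \<open>?as\<close>,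
    whose length n - t is below n - t + 1. Converting u letters behind a block of c + 1 letters t
    uses the parameters c, ..., c + u - 1.\<close>
  have "word_rel n (n - t + 1) x (?as @ replicate (Suc c) t @ replicate u h @ [])
      (?as @ replicate (Suc c + u) t @ [])"
    using as assms
    by (intro word_rel_replace_block[of "c + u"] word_rel_replace) (auto simp: r_def simp del: upt_Suc)
  then have "equiv_mon n (n - t + 1)
      (mono_pol (word_mon n x (?as @ replicate (e - r) t @ replicate u h)))
      (mono_pol (word_mon n x (?as @ replicate (d - r) t)))"
    unfolding c e(3) append_Nil2 by (rule word_rel_imp_equiv_mon) fact
  moreover have "mono_pol (word_mon n x (?as @ replicate (e - r) t @ replicate u h))
      = phi t [t+1..<n+1] (X_all (n - 1) ^ (2 ^ e - 1))
        * X_omit n h ^ (2 ^ d - 2 ^ e) * mono_pol x ^ (2 ^ d)"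
  proof -
    have len: "length (?as @ replicate (e - r) t) = e" using as(2) e(1) by simp
    \<comment> \<open>This is the exponent contributed by u letters h starting at position
      e.\<close>
    have "(2 :: nat) ^ d - 2 ^ e = (2 ^ u - 1) * 2 ^ e"
      by (simp add: e(2) power_add diff_mult_distrib2 mult.commute)
    moreover have "(2 :: nat) ^ d = 2 ^ u * 2 ^ e"
      by (simp add: e(2) power_add)
    ultimately show ?thesis
      unfolding append_assoc [symmetric] word_mon_append[of _ _ "?as @ replicate (e - r) t"]
        mono_pol_word_mon[of _ "word_mon n x (replicate u h)"] len mono_pol_word_mon_replicate
        phi[OF e(1)] power_mult_distrib
      by (simp only: mult.assoc flip: power_mult)
  qed
  moreover have "mono_pol (word_mon n x (?as @ replicate (d - r) t))
      = phi t [t+1..<n+1] (X_all (n - 1) ^ (2 ^ d - 1)) * mono_pol x ^ (2 ^ d)"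
  proof -
    have len: "length (?as @ replicate (d - r) t) = d" using as(2) e by simp
    have "r < d" using e by simp
    then show ?thesis by (simp only: phi mono_pol_word_mon[of n x] len)
  qed
  ultimately show ?thesis by (simp only: e_def)
qed

end
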